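(* Let $G$ be a 3-connected graph (not necessarily finite), $G'$ a graph that is not a circuit, and $f:G\rightarrow G'$ a circuit surjection. Then $f$ is induced by a vertex isomorphism, i.e. there is a bijection $\varphi:V(G)\to V(G')$ such that $f(uv)=\varphi(u)\varphi(v)$ for every edge $uv$ of $G$.
   Context: Graphs are undirected, without loops or multiple edges, possibly infinite. A circuit surjection $f:G\rightarrow G'$ is a map from $E(G)$ onto $E(G')$ such that for every circuit $C$ of $G$, $f(C)$ is a circuit of $G'$; $G'$ is required to have no isolated vertices. "$G'$ is not a circuit" means $G'$ is not itself a single cycle. *)

theory Defs
  imports Main
begin

definition simple_graph :: "'a set \<Rightarrow> 'a set set \<Rightarrow> bool" where
  "simple_graph V E \<longleftrightarrow> (\<forall>e\<in>E. \<exists>u v. u \<in> V \<and> v \<in> V \<and> u \<noteq> v \<and> e = {u, v})"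

definition is_circuit :: "'a set \<Rightarrow> 'a set set \<Rightarrow> 'a set set \<Rightarrow> bool" where
  "is_circuit V E C \<longleftrightarrow> (\<exists>vs. length vs \<ge> 3 \<and> distinct vs \<and> set vs \<subseteq> V \<and>
      C = {{vs ! i, vs ! ((i + 1) mod length vs)} | i. i < length vs} \<and> C \<subseteq> E)"

definition graph_connected :: "'a set \<Rightarrow> 'a set set \<Rightarrow> bool" where
  "graph_connected V E \<longleftrightarrow> V \<noteq> {} \<and> (\<forall>u\<in>V. \<forall>v\<in>V. \<exists>ps. ps \<noteq> [] \<and> hd ps = u \<and> last ps = v \<and>
      set ps \<subseteq> V \<and> (\<forall>i. i + 1 < length ps \<longrightarrow> {ps ! i, ps ! (i + 1)} \<in> E))"

definition k_connected :: "nat \<Rightarrow> 'a set \<Rightarrow> 'a set set \<Rightarrow> bool" where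
  "k_connected k V E \<longleftrightarrow> (infinite V \<or> card V > k) \<and>
     (\<forall>S. S \<subseteq> V \<and> finite S \<and> card S < k \<longrightarrow> graph_connected (V - S) {e \<in> E. e \<inter> S = {}})"

definition no_isolated_vertices :: "'a set \<Rightarrow> 'a set set \<Rightarrow> bool" where
  "no_isolated_vertices V E \<longleftrightarrow> (\<forall>v\<in>V. \<exists>e\<in>E. v \<in> e)"

definition circuit_surjection ::
  "'a set \<Rightarrow> 'a set set \<Rightarrow> 'b set \<Rightarrow> 'b set set \<Rightarrow> ('a set \<Rightarrow> 'b set) \<Rightarrow> bool" where
  "circuit_surjection V E V' E' f \<longleftrightarrow> f ` E = E' \<and>
     (\<forall>C. is_circuit V E C \<longrightarrow> is_circuit V' E' (f ` C))"

end

theory Submission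
  imports Defs
begin

text \<open>
  Circuits are the minimal nonempty finite even edge sets, so sums modulo 2 are available on both
  sides of \<open>f\<close>. In a theta graph whose three circuits do not all have the same image, the images of
  the three arcs are disjoint; together with the facts that in \<open>G\<close> any two edges lie on a common circuit
  and are separated by some circuit, this forces \<open>f\<close> to be injective.

  Hence for each vertex \<open>x\<close> of \<open>G'\<close> the set \<open>D\<close> of edges whose image contains \<open>x\<close> meets every circuit
  in zero or two edges, so \<open>D\<close> is the set of edges between some \<open>X\<close> and its complement. If neither side is
  a single vertex, 3-connectedness makes \<open>D\<close> a matching between two 2-connected sides. Following the image of
  a circuit that has edges inside both sides yields a second vertex \<open>z\<close> whose cut crosses \<open>X\<close>;
  two such cuts cannot cross. So every \<open>D\<close> is the star of a vertex of \<open>G\<close>, and this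
  correspondence of vertices is the inverse of the required bijection.
\<close>

subsection \<open>Even edge sets and injectivity\<close>

text \<open>The finite members of the cycle space modulo 2. No vertex set enters, so the notion
  serves both graphs, and finiteness keeps degrees meaningful in infinite ones.\<close>

definition even_set :: "'a set set \<Rightarrow> bool" where
  "even_set F \<longleftrightarrow> finite F \<and> (\<forall>v. even (card {e\<in>F. v \<in> e}))"

definition circ :: "'a set set \<Rightarrow> bool" where
  "circ C \<longleftrightarrow> even_set C \<and> C \<noteq> {} \<and> (\<forall>F\<subseteq>C. even_set F \<longrightarrow> F \<noteq> {} \<longrightarrow> F = C)"

lemma even_card_sym_diff:
  assumes "finite A" "finite B"
  shows "even (card (sym_diff A B)) \<longleftrightarrow> (even (card A) \<longleftrightarrow> even (card B))"
proof -
  have "card A = card (A - B) + card (A \<inter> B)"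
    using assms by (metis Int_commute card_Diff_subset_Int card_mono finite_Int inf_le1 le_add_diff_inverse2)
  moreover have "card B = card (B - A) + card (A \<inter> B)"
    using assms by (metis Int_commute card_Diff_subset_Int card_mono finite_Int inf_le1 le_add_diff_inverse2)
  moreover have "card (sym_diff A B) = card (A - B) + card (B - A)"
    using assms by (intro card_Un_disjoint) auto
  ultimately show ?thesis by (simp add: even_add) blast
qed

lemma even_degree_sym_diff:
  assumes "finite F" "finite G"
  shows "even (card {e \<in> sym_diff F G. v \<in> e}) \<longleftrightarrow>
    (even (card {e\<in>F. v \<in> e}) \<longleftrightarrow> even (card {e\<in>G. v \<in> e}))"
proof -
  have "{e \<in> sym_diff F G. v \<in> e} = sym_diff {e\<in>F. v \<in> e} {e\<in>G. v \<in> e}" by auto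
  then show ?thesis using assms even_card_sym_diff[of "{e\<in>F. v \<in> e}" "{e\<in>G. v \<in> e}"] by simp
qed

lemma even_set_sym_diff:
  assumes "even_set F" "even_set G"
  shows "even_set (sym_diff F G)"
proof -
  have "finite F" "finite G" using assms by (simp_all add: even_set_def)
  then show ?thesis
    unfolding even_set_def even_degree_sym_diff[OF \<open>finite F\<close> \<open>finite G\<close>]
    using assms by (simp add: even_set_def)
qed

lemma circ_even_set: "circ C \<Longrightarrow> even_set C"
  by (simp add: circ_def)

lemma circ_finite: "circ C \<Longrightarrow> finite C"
  by (simp add: circ_def even_set_def)

lemma circ_minimal: "circ C \<Longrightarrow> F \<subseteq> C \<Longrightarrow> even_set F \<Longrightarrow> F \<noteq> {} \<Longrightarrow> F = C"
  by (simp add: circ_def)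

text \<open>A nonminimal even set splits into two smaller nonempty even sets \<open>G\<close> and
  \<open>F - G\<close>, and \<open>e\<close> lies in one of them.\<close>

lemma even_set_contains_circ:
  assumes "even_set F" "e \<in> F"
  shows "\<exists>C\<subseteq>F. circ C \<and> e \<in> C"
proof -
  have "finite F" using assms by (simp add: even_set_def)
  then show ?thesis using assms
  proof (induction F rule: finite_psubset_induct)
    case (psubset F)
    show ?case
    proof (cases "circ F")
      case False
      then obtain G where G: "G \<subset> F" "even_set G" "G \<noteq> {}"
        using psubset.prems by (auto simp: circ_def)
      have "sym_diff F G = F - G" using G by auto
      then have d: "even_set (F - G)" using even_set_sym_diff[OF psubset.prems(1) G(2)] by simp
      have "F - G \<subset> F" using G by auto
      then show ?thesis
        using psubset.IH[OF G(1) G(2)] psubset.IH[OF _ d] psubset.prems(2) G(1)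
        by (cases "e \<in> G") blast+
    qed (use psubset.prems in auto)
  qed
qed

text \<open>If the first two circuits differ, their sum is a nonempty even subset of the third and
  hence all of it; but the sum misses \<open>A Int B\<close>.\<close>

lemma three_arcs_equal:
  assumes "circ (A \<union> B)" "circ (A \<union> G)" "circ (B \<union> G)" "A \<inter> B \<noteq> {}"
  shows "A \<union> B = A \<union> G"
proof (rule ccontr)
  assume ne: "A \<union> B \<noteq> A \<union> G"
  have "sym_diff (A \<union> B) (A \<union> G) = B \<union> G"
    using ne by (intro circ_minimal[OF assms(3)] even_set_sym_diff circ_even_set assms) auto
  then show False using assms(4) by blast
qed

text \<open>The parts \<open>C1 Int C2\<close>, \<open>C1 - C2\<close> and \<open>C2 - C1\<close>
  unite pairwise to circuits, and so do their images. The common value of \<open>e\<close> and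
  \<open>g\<close> makes the images of two parts overlap, which is the situation of
  \<open>three_arcs_equal\<close>.\<close>

lemma theta_same_image:
  assumes "\<And>C. circ C \<Longrightarrow> C \<subseteq> E \<Longrightarrow> circ (f ` C)"
    and "circ C1" "circ C2" "circ (sym_diff C1 C2)" "C1 \<subseteq> E" "C2 \<subseteq> E"
    and "e \<in> C1 \<inter> C2" "g \<in> C1 - C2" "f e = f g"
  shows "f ` C1 = f ` C2"
proof -
  have 1: "f ` C1 = f ` (C1 \<inter> C2) \<union> f ` (C1 - C2)" by blast
  have 2: "f ` C2 = f ` (C1 \<inter> C2) \<union> f ` (C2 - C1)" by blast
  have 3: "f ` sym_diff C1 C2 = f ` (C1 - C2) \<union> f ` (C2 - C1)" by blast
  have i: "circ (f ` C1)" "circ (f ` C2)" "circ (f ` sym_diff C1 C2)"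
    using assms by blast+
  have "f ` (C1 \<inter> C2) \<inter> f ` (C1 - C2) \<noteq> {}" using assms(7-9) by blast
  with i show ?thesis unfolding 1 2 3 by (rule three_arcs_equal)
qed

text \<open>Among the circuits through \<open>h\<close> that meet \<open>C\<close>, one with fewest edges outside \<open>C\<close>
  forms a theta graph with \<open>C\<close>.\<close>

lemma ear_exists:
  assumes "circ C" "circ D0" "h \<in> D0" "h \<notin> C" "D0 \<inter> C \<noteq> {}"
  shows "\<exists>D. circ D \<and> D \<subseteq> C \<union> D0 \<and> h \<in> D \<and> D \<inter> C \<noteq> {} \<and> circ (sym_diff C D) \<and>
    (\<forall>F. even_set F \<longrightarrow> F \<subseteq> C \<union> D \<longrightarrow> F = {} \<or> F = C \<or> F = D \<or> F = sym_diff C D)"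
proof -
  define P where "P D \<longleftrightarrow> circ D \<and> D \<subseteq> C \<union> D0 \<and> h \<in> D \<and> D \<inter> C \<noteq> {}" for D
  have "P D0" using assms by (auto simp: P_def)
  then obtain D where D: "P D" and min: "\<And>X. P X \<Longrightarrow> card (D - C) \<le> card (X - C)"
    using ex_has_least_nat[of P D0 "\<lambda>D. card (D - C)"] by blast
  have D': "circ D" "D \<subseteq> C \<union> D0" "h \<in> D" "D \<inter> C \<noteq> {}" using D by (auto simp: P_def)
  have through: "F = D \<or> F = sym_diff C D" if F: "even_set F" "F \<subseteq> C \<union> D" "h \<in> F" for F
  proof -
    obtain X where X: "X \<subseteq> F" "circ X" "h \<in> X"
      using even_set_contains_circ[OF F(1,3)] by blast
    \<comment> \<open>A circuit in \<open>F\<close> that misses \<open>C\<close> lies in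
      \<open>D\<close> and so equals \<open>D\<close>, which meets \<open>C\<close>. Hence
      \<open>X\<close> competes with \<open>D\<close> for the fewest edges outside
      \<open>C\<close>.\<close>
    have "X \<inter> C \<noteq> {}"
    proof
      assume "X \<inter> C = {}"
      then have "X \<subseteq> D" using X F by blast
      then have "X = D" using circ_minimal[OF D'(1)] X circ_even_set by blast
      then show False using D'(4) \<open>X \<inter> C = {}\<close> by blast
    qed
    then have "P X" using X F D' by (auto simp: P_def)
    then have "card (D - C) \<le> card (X - C)" by (rule min)
    moreover have "X - C \<subseteq> D - C" using X F by blast
    moreover have "finite (D - C)" using circ_finite[OF D'(1)] by simp
    ultimately have "X - C = D - C" by (simp add: card_seteq)
    then have "F - C = D - C" using X F by blast
    then have "sym_diff F D \<subseteq> C" by blast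
    moreover have "even_set (sym_diff F D)"
      using F D'(1) circ_even_set even_set_sym_diff by blast
    ultimately have "sym_diff F D = {} \<or> sym_diff F D = C"
      using circ_minimal[OF assms(1)] by blast
    then show ?thesis by blast
  qed
  \<comment> \<open>The cycle space of \<open>C Un D\<close> has only four members; a set without
    \<open>h\<close> is reduced to one through \<open>h\<close> by adding \<open>D\<close>.\<close>
  have four: "F = {} \<or> F = C \<or> F = D \<or> F = sym_diff C D" if F: "even_set F" "F \<subseteq> C \<union> D" for F
  proof (cases "h \<in> F")
    case False
    have "even_set (sym_diff F D)"
      using F D'(1) circ_even_set even_set_sym_diff by blast
    moreover have "sym_diff F D \<subseteq> C \<union> D" "h \<in> sym_diff F D" using F False D' by blast+
    ultimately have "sym_diff F D = D \<or> sym_diff F D = sym_diff C D" by (rule through)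
    then show ?thesis by blast
  qed (use through[OF F] in blast)
  have "even_set (sym_diff C D)"
    using assms(1) D'(1) circ_even_set even_set_sym_diff by blast
  moreover have "sym_diff C D \<noteq> {}" using D' assms by blast
  moreover have "F = sym_diff C D" if "F \<subseteq> sym_diff C D" "even_set F" "F \<noteq> {}" for F
  proof -
    have "F \<noteq> C" "F \<noteq> D" using that(1) D'(4) by blast+
    moreover have "F \<subseteq> C \<union> D" using that(1) by blast
    ultimately show ?thesis using four[OF that(2)] that(3) by blast
  qed
  ultimately have "circ (sym_diff C D)" by (simp add: circ_def)
  then show ?thesis using D' four by blast
qed

text \<open>Take a circuit \<open>X\<close> through \<open>h\<close> that forms a theta graph with
  \<open>C\<close>. If \<open>X\<close> misses \<open>e\<close>, the sum of \<open>C\<close> and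
  \<open>X\<close> contains both \<open>e\<close> and \<open>h\<close>.\<close>

lemma circ_trans:
  assumes "circ C" "circ D" "e \<in> C" "h \<in> D" "C \<inter> D \<noteq> {}"
  shows "\<exists>X\<subseteq>C \<union> D. circ X \<and> e \<in> X \<and> h \<in> X"
proof (cases "h \<in> C")
  case True
  then show ?thesis using assms by blast
next
  case False
  obtain X where X: "circ X" "X \<subseteq> C \<union> D" "h \<in> X" "circ (sym_diff C X)"
    using ear_exists[OF assms(1,2,4) False] assms(5) by blast
  show ?thesis
  proof (cases "e \<in> X")
    case False
    then have "e \<in> sym_diff C X" "h \<in> sym_diff C X" "sym_diff C X \<subseteq> C \<union> D"
      using X assms \<open>h \<notin> C\<close> by blast+
    then show ?thesis using X by blast
  qed (use X in blast)
qed

text \<open>If \<open>f e = f g\<close>, theta graphs with \<open>e\<close> and \<open>g\<close> on different arcs have constant image, and a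
  suitable circuit \<open>B\<close> links two circuits \<open>C\<close>, \<open>D\<close> with different images by such thetas.\<close>

lemma circuit_map_inj:
  assumes pres: "\<And>C. circ C \<Longrightarrow> C \<subseteq> E \<Longrightarrow> circ (f ` C)"
    and common: "\<And>e g. e \<in> E \<Longrightarrow> g \<in> E \<Longrightarrow> \<exists>C\<subseteq>E. circ C \<and> e \<in> C \<and> g \<in> C"
    and separate: "\<And>e g. e \<in> E \<Longrightarrow> g \<in> E \<Longrightarrow> e \<noteq> g \<Longrightarrow> \<exists>C\<subseteq>E. circ C \<and> e \<in> C \<and> g \<notin> C"
    and onto: "\<And>C. circ C \<Longrightarrow> C \<subseteq> E \<Longrightarrow> f ` C \<noteq> f ` E"
  shows "inj_on f E"
proof (rule inj_onI, rule ccontr)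
  fix e g assume e: "e \<in> E" and g: "g \<in> E" and fe: "f e = f g" and ne: "e \<noteq> g"
  have same: "f ` C1 = f ` C2" if "circ C1" "circ C2" "circ (sym_diff C1 C2)" "C1 \<subseteq> E" "C2 \<subseteq> E"
    "a \<in> C1 \<inter> C2" "b \<in> C1 - C2" "f a = f b" for C1 C2 a b
    using theta_same_image[of E f C1 C2 a b] pres that by blast
  obtain C where C: "C \<subseteq> E" "circ C" "e \<in> C" "g \<in> C" using common[OF e g] by blast
  \<comment> \<open>Every circuit through \<open>h\<close> has an image different from that of
    \<open>C\<close>.\<close>
  obtain h where h: "h \<in> E" "f h \<notin> f ` C" using onto[OF C(2,1)] C(1) by blast
  then have hC: "h \<notin> C" by blast
  obtain D0 where D0: "D0 \<subseteq> E" "circ D0" "e \<in> D0" "h \<in> D0" using common[OF e h(1)] by blast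
  have "D0 \<inter> C \<noteq> {}" using D0 C by blast
  from ear_exists[OF C(2) D0(2,4) hC this]
  obtain D1 where D1: "circ D1" "D1 \<subseteq> C \<union> D0" "h \<in> D1" "D1 \<inter> C \<noteq> {}" "circ (sym_diff C D1)"
    and four1: "\<And>F. even_set F \<Longrightarrow> F \<subseteq> C \<union> D1 \<Longrightarrow> F = {} \<or> F = C \<or> F = D1 \<or> F = sym_diff C D1"
    by blast
  have D1E: "D1 \<subseteq> E" using D1 C D0 by blast
  have nim: "f ` C \<noteq> f ` D1" using D1 h by blast
  \<comment> \<open>If \<open>D1\<close> separated \<open>e\<close> from \<open>g\<close>, then
    \<open>theta_same_image\<close> would give \<open>C\<close> and \<open>D1\<close> equal
    images.\<close>
  have both: "e \<in> D1 \<longleftrightarrow> g \<in> D1"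
    using same[OF C(2) D1(1) D1(5) C(1) D1E, of e g] same[OF C(2) D1(1) D1(5) C(1) D1E, of g e]
      nim fe C by (metis DiffI IntI)
  \<comment> \<open>Of \<open>D1\<close> and the sum of \<open>C\<close> and \<open>D1\<close>, take
    the one that contains \<open>e\<close> and \<open>g\<close>; both contain \<open>h\<close> and
    span the same theta graph with \<open>C\<close>.\<close>
  obtain D where D: "circ D" "D \<subseteq> E" "h \<in> D" "e \<in> D" "g \<in> D" "circ (sym_diff C D)"
    and four: "\<And>F. even_set F \<Longrightarrow> F \<subseteq> C \<union> D \<Longrightarrow> F = {} \<or> F = C \<or> F = D \<or> F = sym_diff C D"
  proof (cases "e \<in> D1")
    case True
    then show ?thesis using that[of D1] D1 D1E both four1 by blast
  next
    case False
    have eq: "sym_diff C (sym_diff C D1) = D1" "C \<union> sym_diff C D1 = C \<union> D1" by blast+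
    show ?thesis
    proof (rule that[of "sym_diff C D1"])
      show "F = {} \<or> F = C \<or> F = sym_diff C D1 \<or> F = sym_diff C (sym_diff C D1)"
        if "even_set F" "F \<subseteq> C \<union> sym_diff C D1" for F
        using four1[of F] that unfolding eq by blast
      show "circ (sym_diff C (sym_diff C D1))" unfolding eq by (rule D1(1))
    qed (use D1 D1E False both C hC in auto)
  qed
  have nimD: "f ` C \<noteq> f ` D" using D h by blast
  \<comment> \<open>The circuits that separate \<open>e\<close> from \<open>g\<close>;
    \<open>B\<close> is one with fewest edges outside the theta graph.\<close>
  define Q where "Q B \<longleftrightarrow> circ B \<and> B \<subseteq> E \<and> (e \<in> B \<longleftrightarrow> g \<notin> B)" for B
  obtain B0 where "Q B0" using separate[OF e g ne] by (auto simp: Q_def)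
  then obtain B where B: "Q B" and min: "\<And>X. Q X \<Longrightarrow> card (B - (C \<union> D)) \<le> card (X - (C \<union> D))"
    using ex_has_least_nat[of Q B0 "\<lambda>B. card (B - (C \<union> D))"] by blast
  text \<open>By minimality, whatever \<open>sym_diff Y C'\<close> contains besides one circuit lies in the theta
    \<open>C \<union> D\<close> and avoids \<open>e\<close> and \<open>g\<close>, hence can only be \<open>sym_diff C D\<close>.\<close>
  have split: "circ (sym_diff Y C') \<or>
      (circ (sym_diff Y D') \<and> D' - C' \<subseteq> Y \<and> Y \<inter> (C' - D') = {})"
    if Y: "Q Y" "card (Y - (C \<union> D)) \<le> card (B - (C \<union> D))"
      and CD: "C' = C \<and> D' = D \<or> C' = D \<and> D' = C" for Y C' D'
  proof -
    have C'D': "circ C'" "circ D'" "C' \<subseteq> E" "D' \<subseteq> E" "C' \<union> D' = C \<union> D" "e \<in> C'" "g \<in> C'"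
      "e \<in> D'" "g \<in> D'" "sym_diff C' D' = sym_diff C D"
      using CD C D by auto
    have Y': "circ Y" "Y \<subseteq> E" "e \<in> Y \<longleftrightarrow> g \<notin> Y" using Y by (auto simp: Q_def)
    have ev: "even_set (sym_diff Y C')"
      using Y'(1) C'D'(1) by (intro even_set_sym_diff circ_even_set)
    obtain x where x: "x \<in> sym_diff Y C'" "x = e \<or> x = g" using Y'(3) C'D'(6,7) by blast
    obtain W where W: "W \<subseteq> sym_diff Y C'" "circ W" "x \<in> W"
      using even_set_contains_circ[OF ev x(1)] by blast
    have "W \<subseteq> E" using W(1) Y'(2) C'D'(3) by blast
    moreover have "e \<in> W \<longleftrightarrow> g \<notin> W" using W(1,3) x Y'(3) C'D'(6,7) by blast
    ultimately have "Q W" using W(2) by (simp add: Q_def)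
    then have "card (Y - (C \<union> D)) \<le> card (W - (C \<union> D))" using min Y(2) le_trans by blast
    moreover have "W - (C \<union> D) \<subseteq> Y - (C \<union> D)" using W(1) C'D'(5) by blast
    moreover have "finite (Y - (C \<union> D))" using circ_finite[OF Y'(1)] by blast
    ultimately have eqW: "W - (C \<union> D) = Y - (C \<union> D)" by (simp add: card_seteq)
    define Z where "Z = sym_diff Y C' - W"
    have Zs: "Z = sym_diff (sym_diff Y C') W" using W(1) unfolding Z_def by blast
    have evZ: "even_set Z" unfolding Zs
      by (rule even_set_sym_diff[OF ev circ_even_set[OF W(2)]])
    moreover have ZCD: "Z \<subseteq> C \<union> D" using eqW C'D'(5) unfolding Z_def by blast
    moreover have "\<not> (e \<in> Z \<or> g \<in> Z)" using x W(3) C'D'(6,7) Y'(3) unfolding Z_def by blast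
    ultimately have "Z = {} \<or> Z = sym_diff C D" using four[of Z] C(3) D(4) by blast
    then show ?thesis
    proof
      assume "Z = {}"
      then have "W = sym_diff Y C'" using W(1) unfolding Z_def by blast
      then show ?thesis using W(2) by blast
    next
      assume Z: "Z = sym_diff C D"
      then have Z': "Z = sym_diff C' D'" using C'D' by simp
      have "sym_diff Y D' = W" using Zs unfolding Z' by blast
      moreover have "D' - C' \<subseteq> Y" "Y \<inter> (C' - D') = {}" using Z' unfolding Z_def by blast+
      ultimately show ?thesis using W(2) by blast
    qed
  qed
  \<comment> \<open>A separating circuit whose sums with \<open>C\<close> and with \<open>D\<close>
    are both circuits has the image of \<open>C\<close> as well as that of \<open>D\<close>, yet
    these differ.\<close>
  have fin: "False" if Y: "Q Y" and YC: "circ (sym_diff Y C)" and YD: "circ (sym_diff Y D)" for Y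
  proof -
    have Y': "circ Y" "Y \<subseteq> E" "e \<in> Y \<longleftrightarrow> g \<notin> Y" using Y by (auto simp: Q_def)
    have key: "f ` X = f ` Y" if "circ X" "circ (sym_diff Y X)" "X \<subseteq> E" "e \<in> X" "g \<in> X" for X
    proof -
      have "circ (sym_diff X Y)" using that(2) by (simp add: Un_commute)
      then show ?thesis
        using same[of X Y e g] same[of X Y g e] that Y' fe by (metis DiffI IntI)
    qed
    show False using key[OF C(2) YC C(1,3,4)] key[OF D(1) YD D(2,4,5)] nimD by simp
  qed
  have step: False if CD: "C' = C \<and> D' = D \<or> C' = D \<and> D' = C"
      and bad: "\<not> circ (sym_diff B C')" "D' - C' \<noteq> {}" for C' D'
  proof -
    have s: "circ (sym_diff B D')" "D' - C' \<subseteq> B" "B \<inter> (C' - D') = {}"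
      using split[OF B _ CD] bad by auto
    \<comment> \<open>Replacing \<open>B\<close> by its sum with \<open>D'\<close> keeps it
      separating and minimal, and \<open>Y\<close> now avoids \<open>D' - C'\<close>. This rules out
      the second alternative of \<open>split\<close>, so \<open>fin\<close> applies to
      \<open>Y\<close>.\<close>
    define Y where "Y = sym_diff B D'"
    have YD: "sym_diff Y D' = B" unfolding Y_def by blast
    have "e \<in> D'" "g \<in> D'" "D' \<subseteq> E" using CD C D by auto
    then have QY: "Q Y" using B s(1) unfolding Q_def Y_def by blast
    have "Y - (C \<union> D) = B - (C \<union> D)" using CD unfolding Y_def by blast
    then have "circ (sym_diff Y C')"
      using split[OF QY _ CD] bad(2) s(2) unfolding Y_def by auto
    moreover have "circ (sym_diff Y D')" unfolding YD using B by (simp add: Q_def)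
    ultimately show False using fin[OF QY] CD by blast
  qed
  have "C - D \<noteq> {}"
  proof
    assume "C - D = {}"
    then have "C = D" using circ_minimal[OF D(1), of C] C circ_even_set by blast
    then show False using hC D by blast
  qed
  moreover have "D - C \<noteq> {}" using hC D by blast
  ultimately show False using step[of C D] step[of D C] fin[OF B] by blast
qed

subsection \<open>Circuits as minimal even sets\<close>

definition pairs :: "'a set set \<Rightarrow> bool" where
  "pairs E \<longleftrightarrow> (\<forall>e\<in>E. card e = 2)"

definition boundary :: "'a set set \<Rightarrow> 'a set \<Rightarrow> 'a set set" where
  "boundary E X = {e\<in>E. e \<inter> X \<noteq> {} \<and> \<not> e \<subseteq> X}"

lemma simple_graph_pairs: "simple_graph V E \<Longrightarrow> pairs E"
  by (auto simp: simple_graph_def pairs_def)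

lemma pairs_subset: "pairs E \<Longrightarrow> F \<subseteq> E \<Longrightarrow> pairs F"
  by (auto simp: pairs_def)

lemma pairsE:
  assumes "pairs E" "e \<in> E" "v \<in> e"
  obtains w where "e = {v, w}" "w \<noteq> v"
proof -
  have "card e = 2" using assms by (simp add: pairs_def)
  then obtain a b where "e = {a, b}" "a \<noteq> b" by (auto simp: card_2_iff)
  then show thesis using assms(3) that by auto
qed

text \<open>The degrees over \<open>X\<close> sum to an even number. An edge contributes one for
  each end in \<open>X\<close>, and the boundary edges are those contributing exactly one.\<close>

lemma even_boundary:
  assumes "pairs F" "even_set F"
  shows "even (card (boundary F X))"
proof -
  have fin: "finite F" using assms by (simp add: even_set_def)
  have fe: "finite e" if "e \<in> F" for e using assms(1) that by (auto simp: pairs_def intro: card_ge_0_finite)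
  \<comment> \<open>\<open>X\<close> may be infinite; only the ends of edges of \<open>F\<close>
    count.\<close>
  define X' where "X' = X \<inter> \<Union>F"
  have finX: "finite X'" unfolding X'_def using fin fe by auto
  have "(\<Sum>v\<in>X'. card {e\<in>F. v \<in> e}) = (\<Sum>v\<in>X'. \<Sum>e\<in>F. of_bool (v \<in> e))"
    using fin by (simp add: Int_def)
  also have "\<dots> = (\<Sum>e\<in>F. \<Sum>v\<in>X'. of_bool (v \<in> e))" by (rule sum.swap)
  also have "\<dots> = (\<Sum>e\<in>F. card (e \<inter> X))"
  proof (rule sum.cong)
    fix e assume "e \<in> F"
    then have "{v \<in> X'. v \<in> e} = e \<inter> X" by (auto simp: X'_def)
    then show "(\<Sum>v\<in>X'. of_bool (v \<in> e)) = card (e \<inter> X)" using finX by (simp add: Int_def)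
  qed simp
  finally have "even (\<Sum>e\<in>F. card (e \<inter> X))"
    using assms(2) dvd_sum[of X' 2 "\<lambda>v. card {e\<in>F. v \<in> e}"] by (simp add: even_set_def)
  then have "even (card {e\<in>F. odd (card (e \<inter> X))})" using fin by (simp add: even_sum_iff)
  moreover have "{e\<in>F. odd (card (e \<inter> X))} = boundary F X"
  proof -
    have "odd (card (e \<inter> X)) \<longleftrightarrow> e \<inter> X \<noteq> {} \<and> \<not> e \<subseteq> X" if e: "e \<in> F" for e
    proof -
      obtain a b where ab: "e = {a, b}" "a \<noteq> b"
        using e assms(1) by (auto simp: pairs_def card_2_iff)
      show ?thesis unfolding ab(1) using ab(2) by (cases "a \<in> X"; cases "b \<in> X") auto
    qed
    then show ?thesis by (auto simp: boundary_def)
  qed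
  ultimately show ?thesis by simp
qed

text \<open>With no boundary edge, the edges of \<open>C\<close> that meet \<open>X\<close> would
  form a nonempty even subset without \<open>g\<close>, against minimality. Parity then raises one
  boundary edge to two.\<close>

lemma circ_boundary:
  assumes "pairs C" "circ C" "e \<in> C" "e \<inter> X \<noteq> {}" "g \<in> C" "\<not> g \<subseteq> X"
  shows "card (boundary C X) \<ge> 2"
proof -
  have "boundary C X \<noteq> {}"
  proof
    assume b: "boundary C X = {}"
    define G where "G = {e\<in>C. e \<inter> X \<noteq> {}}"
    have inX: "d \<subseteq> X" if "d \<in> G" for d using b that by (auto simp: boundary_def G_def)
    have "even (card {e\<in>G. v \<in> e})" for v
    proof (cases "v \<in> X")
      case True
      then have "{e\<in>G. v \<in> e} = {e\<in>C. v \<in> e}" by (auto simp: G_def)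
      then show ?thesis using assms(2) by (simp add: circ_def even_set_def)
    next
      case False
      then have "{e\<in>G. v \<in> e} = {}" using inX by auto
      then show ?thesis by (metis card.empty even_zero)
    qed
    then have "even_set G" using circ_finite[OF assms(2)] by (simp add: even_set_def G_def)
    moreover have "G \<subseteq> C" "e \<in> G" using assms by (auto simp: G_def)
    ultimately have "G = C" using circ_minimal[OF assms(2)] by blast
    then show False using assms(5,6) inX by blast
  qed
  moreover have "finite (boundary C X)" using circ_finite[OF assms(2)] by (simp add: boundary_def)
  ultimately have "card (boundary C X) \<noteq> 0" by simp
  moreover have "even (card (boundary C X))"
    using assms(1,2) by (intro even_boundary circ_even_set)
  ultimately show ?thesis by (metis One_nat_def Suc_1 Suc_leI even_Suc even_zero le_neq_implies_less neq0_conv)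
qed

text \<open>A nonempty even subset cannot stop at a vertex of the cycle: with one edge it contains
  the next, and so all of them.\<close>

lemma is_circuit_circ:
  assumes "is_circuit V E C"
  shows "circ C" "C \<subseteq> E" "card {e\<in>C. v \<in> e} \<le> 2"
proof -
  obtain vs where vs: "length vs \<ge> 3" "distinct vs"
    "C = {{vs ! i, vs ! ((i + 1) mod length vs)} | i. i < length vs}" "C \<subseteq> E"
    using assms unfolding is_circuit_def by blast
  define n where "n = length vs"
  define s where "s i = (i + 1) mod n" for i
  define ed where "ed i = {vs ! i, vs ! s i}" for i
  have n: "n \<ge> 3" using vs by (simp add: n_def)
  have C: "C = ed ` {..<n}" unfolding vs(3) ed_def s_def n_def by auto
  have sn: "s i < n" for i using n by (simp add: s_def)
  have s_if: "s i = (if i + 1 = n then 0 else i + 1)" if "i < n" for i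
    using that by (auto simp: s_def)
  have s_inj: "s i = s j \<longleftrightarrow> i = j" if "i < n" "j < n" for i j
    using that by (auto simp: s_if split: if_splits)
  have nth: "vs ! i = vs ! j \<longleftrightarrow> i = j" if "i < n" "j < n" for i j
    using that vs(2) by (simp add: n_def nth_eq_iff_index_eq)
  have mem: "vs ! s j \<in> ed k \<longleftrightarrow> k = s j \<or> k = j" if "j < n" "k < n" for j k
    using that by (auto simp: ed_def nth sn s_inj)
  \<comment> \<open>This is where a cycle needs three vertices: on two vertices consecutive edges
    would coincide.\<close>
  have ne: "ed j \<noteq> ed (s j)" if "j < n" for j
  proof
    assume "ed j = ed (s j)"
    then have "vs ! j \<in> {vs ! s j, vs ! s (s j)}" by (auto simp: ed_def)
    then have "j = s j \<or> j = s (s j)" using that by (auto simp: nth sn)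
    then show False using n that by (auto simp: s_if sn split: if_splits)
  qed
  have star: "{e\<in>C. vs ! s j \<in> e} = {ed j, ed (s j)}" if "j < n" for j
    using that sn[of j] by (auto simp: C mem)
  have star0: "{e\<in>C. v \<in> e} = {}" if "v \<notin> set vs" for v
    using that sn by (auto simp: C ed_def n_def)
  have pre: "\<exists>j<n. v = vs ! s j" if v: "v \<in> set vs" for v
  proof -
    obtain k where k: "k < n" "v = vs ! k" using v unfolding in_set_conv_nth n_def by blast
    have "s (if k = 0 then n - 1 else k - 1) = k" using k n by (auto simp: s_def)
    moreover have "(if k = 0 then n - 1 else k - 1) < n" using k n by auto
    ultimately show ?thesis using k(2) by metis
  qed
  have deg: "card {e\<in>C. v \<in> e} = 0 \<or> card {e\<in>C. v \<in> e} = 2" for v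
  proof (cases "v \<in> set vs")
    case True
    then obtain j where "j < n" "v = vs ! s j" using pre by blast
    then show ?thesis using star ne by simp
  next
    case False
    then have "{e\<in>C. v \<in> e} = {}" by (rule star0)
    then show ?thesis by (metis card.empty)
  qed
  have fin: "finite C" by (simp add: C)
  have "even_set C" unfolding even_set_def using fin deg by (metis dvd_refl even_zero)
  moreover have "ed 0 \<in> C" using n by (simp add: C)
  then have "C \<noteq> {}" by blast
  moreover have "F = C" if F: "F \<subseteq> C" "even_set F" "F \<noteq> {}" for F
  proof -
    obtain i where i: "i < n" "ed i \<in> F" using F by (auto simp: C)
    have next_edge: "ed (s j) \<in> F" if "j < n" "ed j \<in> F" for j
    proof (rule ccontr)
      assume "ed (s j) \<notin> F"
      then have "{e\<in>F. vs ! s j \<in> e} = {ed j}"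
        using star[OF that(1)] F(1) that(2) by (auto simp: ed_def)
      then have "card {e\<in>F. vs ! s j \<in> e} = 1" by simp
      then show False using F(2) by (metis even_set_def odd_one)
    qed
    have all: "ed ((i + k) mod n) \<in> F" for k
    proof (induction k)
      case (Suc k)
      have "s ((i + k) mod n) = (i + Suc k) mod n" by (simp add: s_def mod_Suc_eq)
      then show ?case using next_edge[OF _ Suc] n by simp
    qed (use i in simp)
    have "ed j \<in> F" if "j < n" for j
    proof -
      \<comment> \<open>The summand \<open>n\<close> keeps the subtraction of naturals from
        truncating when \<open>j < i\<close>.\<close>
      have "(i + (n + j - i)) mod n = j" using i that by simp
      then show ?thesis using all[of "n + j - i"] by simp
    qed
    then show "F = C" using F(1) by (auto simp: C)
  qed
  ultimately show "circ C" by (simp add: circ_def)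
  show "C \<subseteq> E" by (rule vs(4))
  show "card {e\<in>C. v \<in> e} \<le> 2" using deg[of v] by auto
qed

text \<open>The first vertex of a longest path in \<open>F\<close> has a second edge, by even
  degree. That edge leads back to the path and closes a cycle.\<close>

lemma even_set_contains_is_circuit:
  assumes "simple_graph V E" "F \<subseteq> E" "even_set F" "F \<noteq> {}"
  shows "\<exists>C\<subseteq>F. is_circuit V E C"
proof -
  have pF: "pairs F" using assms(1,2) simple_graph_pairs pairs_subset by blast
  have fin: "finite (\<Union>F)"
  proof (rule finite_Union)
    show "finite e" if "e \<in> F" for e
      using pF that by (auto simp: pairs_def intro: card_ge_0_finite)
  qed (use assms(3) in \<open>simp add: even_set_def\<close>)
  have FV: "\<Union>F \<subseteq> V" using assms(1,2) by (fastforce simp: simple_graph_def)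
  define P where "P vs \<longleftrightarrow> distinct vs \<and> length vs \<ge> 2 \<and> set vs \<subseteq> \<Union>F \<and>
    (\<forall>i. i + 1 < length vs \<longrightarrow> {vs ! i, vs ! (i + 1)} \<in> F)" for vs
  obtain e where "e \<in> F" using assms(4) by blast
  then obtain a b where ab: "{a, b} \<in> F" "a \<noteq> b" using pF by (auto simp: pairs_def card_2_iff)
  have "P [a, b]" using ab by (auto simp: P_def)
  moreover have "length vs \<le> card (\<Union>F)" if "P vs" for vs
    using that fin by (metis P_def card_mono distinct_card)
  ultimately obtain vs where vs: "P vs" and max: "\<And>ws. P ws \<Longrightarrow> length ws \<le> length vs"
    using ex_has_greatest_nat[of P "[a, b]" length "Suc (card (\<Union>F))"] by (auto simp: less_Suc_eq_le)
  define v where "v = vs ! 0"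
  have len: "length vs \<ge> 2" using vs by (simp add: P_def)
  have v1: "{v, vs ! 1} \<in> F" using vs len by (auto simp: P_def v_def)
  have "\<exists>g\<in>F. v \<in> g \<and> g \<noteq> {v, vs ! 1}"
  proof (rule ccontr)
    assume "\<not> ?thesis"
    then have "{e\<in>F. v \<in> e} = {{v, vs ! 1}}" using v1 by blast
    then have "card {e\<in>F. v \<in> e} = 1" by simp
    then show False using assms(3) by (metis even_set_def odd_one)
  qed
  then obtain g where g: "g \<in> F" "v \<in> g" "g \<noteq> {v, vs ! 1}" by blast
  obtain w where w: "g = {v, w}" "w \<noteq> v" using pairsE[OF pF g(1,2)] by blast
  have "w \<in> set vs"
  proof (rule ccontr)
    assume "w \<notin> set vs"
    have "{(w # vs) ! i, (w # vs) ! (i + 1)} \<in> F" if "i + 1 < length (w # vs)" for i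
      using that vs g(1) w by (cases i) (auto simp: P_def v_def insert_commute)
    then have "P (w # vs)" using vs \<open>w \<notin> set vs\<close> g(1) w unfolding P_def by auto
    then show False using max by fastforce
  qed
  then obtain k where k: "k < length vs" "w = vs ! k" by (auto simp: in_set_conv_nth)
  \<comment> \<open>\<open>g\<close> is neither a loop nor the first edge of the path, so the closed
    part has at least three vertices.\<close>
  have "k \<noteq> 0" "k \<noteq> 1" using w g k by (auto simp: v_def intro: ccontr)
  then have k2: "k \<ge> 2" by simp
  define us where "us = take (k + 1) vs"
  have lus: "length us = k + 1" using k by (simp add: us_def)
  have nus: "us ! i = vs ! i" if "i \<le> k" for i using that by (simp add: us_def)
  have edge: "{us ! i, us ! ((i + 1) mod length us)} \<in> F" if "i < length us" for i
  proof (cases "i = k")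
    case True
    then show ?thesis using g(1) w k by (simp add: lus nus v_def insert_commute)
  next
    case False
    then show ?thesis using that vs k by (simp add: lus nus P_def)
  qed
  define C where "C = {{us ! i, us ! ((i + 1) mod length us)} | i. i < length us}"
  have CF: "C \<subseteq> F" using edge by (auto simp: C_def)
  have "is_circuit V E C"
    unfolding is_circuit_def
  proof (intro exI conjI)
    show "C = {{us ! i, us ! ((i + 1) mod length us)} | i. i < length us}" by (rule C_def)
    show "length us \<ge> 3" using lus k2 by simp
    show "distinct us" using vs by (simp add: us_def P_def)
    have "set vs \<subseteq> \<Union>F" using vs by (simp add: P_def)
    then show "set us \<subseteq> V" unfolding us_def using FV set_take_subset by (meson order_trans)
    show "C \<subseteq> E" using CF assms(2) by blast
  qed
  then show ?thesis using CF by blast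
qed

lemma is_circuit_iff:
  assumes "simple_graph V E"
  shows "is_circuit V E C \<longleftrightarrow> circ C \<and> C \<subseteq> E"
proof
  assume C: "circ C \<and> C \<subseteq> E"
  then obtain D where D: "D \<subseteq> C" "is_circuit V E D"
    using even_set_contains_is_circuit[OF assms, of C] by (auto simp: circ_def)
  then have "D = C" using C is_circuit_circ(1)[OF D(2)] by (auto simp: circ_def)
  then show "is_circuit V E C" using D by simp
qed (use is_circuit_circ in blast)

subsection \<open>Connectivity and cuts\<close>

definition adj :: "'a set set \<Rightarrow> ('a \<times> 'a) set" where
  "adj E = {(u, v). {u, v} \<in> E}"

definition induced :: "'a set set \<Rightarrow> 'a set \<Rightarrow> 'a set set" where
  "induced E U = {e\<in>E. e \<subseteq> U}"

text \<open>Connectivity of the subgraph induced by \<open>U\<close>: \<open>E\<close> may contain edges leaving \<open>U\<close>.\<close>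

definition conn :: "'a set set \<Rightarrow> 'a set \<Rightarrow> bool" where
  "conn E U \<longleftrightarrow> U \<noteq> {} \<and>
    (\<forall>X\<subseteq>U. X \<noteq> {} \<longrightarrow> X \<noteq> U \<longrightarrow> (\<exists>a\<in>X. \<exists>b\<in>U - X. {a, b} \<in> E))"

definition two_conn :: "'a set set \<Rightarrow> 'a set \<Rightarrow> bool" where
  "two_conn E U \<longleftrightarrow> (\<exists>a\<in>U. \<exists>b\<in>U. \<exists>c\<in>U. a \<noteq> b \<and> a \<noteq> c \<and> b \<noteq> c) \<and>
    conn E U \<and> (\<forall>v\<in>U. conn E (U - {v}))"

text \<open>The nested form hands over a 2-connected graph after the removal of one vertex, ready
  for the lemmas on common circuits.\<close>

definition three_conn :: "'a set set \<Rightarrow> 'a set \<Rightarrow> bool" where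
  "three_conn E U \<longleftrightarrow> two_conn E U \<and> (\<forall>v\<in>U. two_conn E (U - {v}))"

text \<open>Abstracts what an injective circuit map gives for the edges whose image contains a fixed
  vertex: a circuit has at most two edges at a vertex.\<close>

definition thin :: "'a set set \<Rightarrow> 'a set set \<Rightarrow> bool" where
  "thin E D \<longleftrightarrow> (\<forall>C\<subseteq>E. circ C \<longrightarrow> card (C \<inter> D) \<le> 2)"

lemma induced_subset: "induced E U \<subseteq> E"
  by (auto simp: induced_def)

lemma connD:
  assumes "conn E U" "X \<subseteq> U" "X \<noteq> {}" "X \<noteq> U"
  obtains a b where "a \<in> X" "b \<in> U" "b \<notin> X" "{a, b} \<in> E"
  using assms unfolding conn_def by blast

lemma conn_mono:
  assumes "conn E U" "\<And>a b. a \<in> U \<Longrightarrow> b \<in> U \<Longrightarrow> {a, b} \<in> E \<Longrightarrow> {a, b} \<in> F"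
  shows "conn F U"
  using assms(1) unfolding conn_def
proof (elim conjE, intro conjI allI impI)
  fix X assume X: "X \<subseteq> U" "X \<noteq> {}" "X \<noteq> U"
  obtain a b where "a \<in> X" "b \<in> U" "b \<notin> X" "{a, b} \<in> E" using connD[OF assms(1) X] by blast
  then show "\<exists>a\<in>X. \<exists>b\<in>U - X. {a, b} \<in> F" using assms(2) X by blast
qed

lemma conn_Un:
  assumes "conn E A" "conn E B" "a \<in> A" "b \<in> B" "{a, b} \<in> E"
  shows "conn E (A \<union> B)"
  unfolding conn_def
proof (intro conjI allI impI)
  fix X assume X: "X \<subseteq> A \<union> B" "X \<noteq> {}" "X \<noteq> A \<union> B"
  consider (A) "X \<inter> A \<noteq> {}" "\<not> A \<subseteq> X" | (B) "X \<inter> B \<noteq> {}" "\<not> B \<subseteq> X"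
    | (AB) "A \<subseteq> X" "X \<inter> B = {}" | (BA) "B \<subseteq> X" "X \<inter> A = {}"
    using X by blast
  then show "\<exists>a\<in>X. \<exists>b\<in>A \<union> B - X. {a, b} \<in> E"
  proof cases
    case A
    then obtain c d where "c \<in> X \<inter> A" "d \<in> A" "d \<notin> X \<inter> A" "{c, d} \<in> E"
      using connD[OF assms(1), of "X \<inter> A"] by blast
    then show ?thesis by blast
  next
    case B
    then obtain c d where "c \<in> X \<inter> B" "d \<in> B" "d \<notin> X \<inter> B" "{c, d} \<in> E"
      using connD[OF assms(2), of "X \<inter> B"] by blast
    then show ?thesis by blast
  next
    case AB
    then show ?thesis using assms(3-5) by blast
  next
    case BA
    then show ?thesis using assms(3-5) by (metis DiffI UnI1 disjoint_iff insert_commute subsetD)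
  qed
qed (use assms in blast)

lemma conn_singleton: "conn E {v}"
  unfolding conn_def by blast

lemma conn_reach:
  assumes "conn E U" "u \<in> U" "v \<in> U"
  shows "(u, v) \<in> (adj (induced E U))\<^sup>*"
proof (rule ccontr)
  assume nv: "(u, v) \<notin> (adj (induced E U))\<^sup>*"
  define X where "X = {w\<in>U. (u, w) \<in> (adj (induced E U))\<^sup>*}"
  have "u \<in> X" "v \<notin> X" using assms nv by (auto simp: X_def)
  then obtain a b where ab: "a \<in> X" "b \<in> U" "b \<notin> X" "{a, b} \<in> E"
    using connD[OF assms(1), of X] assms(3) by (auto simp: X_def)
  then have "(a, b) \<in> adj (induced E U)" by (auto simp: X_def adj_def induced_def)
  then show False using ab by (auto simp: X_def intro: rtrancl_into_rtrancl)
qed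

lemma reach_conn:
  assumes "U \<noteq> {}" "\<And>u v. u \<in> U \<Longrightarrow> v \<in> U \<Longrightarrow> (u, v) \<in> (adj (induced E U))\<^sup>*"
  shows "conn E U"
  unfolding conn_def
proof (intro conjI allI impI)
  fix X assume X: "X \<subseteq> U" "X \<noteq> {}" "X \<noteq> U"
  then obtain u v where uv: "u \<in> X" "v \<in> U" "v \<notin> X" by blast
  show "\<exists>a\<in>X. \<exists>b\<in>U - X. {a, b} \<in> E"
  proof (rule ccontr)
    assume no: "\<not> ?thesis"
    have "(u, v) \<in> (adj (induced E U))\<^sup>*" using assms(2) uv X by blast
    then have "v \<in> X"
    proof (induction rule: rtrancl_induct)
      case (step y z)
      then show ?case using no by (auto simp: adj_def induced_def)
    qed (rule uv(1))
    then show False using uv by blast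
  qed
qed (rule assms(1))

section \<open>Circuits through prescribed edges\<close>

lemma reach_odd_set:
  assumes "(u, v) \<in> (adj E)\<^sup>*" "pairs E"
  shows "\<exists>P\<subseteq>E. finite P \<and> (\<forall>w. odd (card {e\<in>P. w \<in> e}) \<longleftrightarrow> (w = u) \<noteq> (w = v))"
  using assms(1)
proof (induction rule: rtrancl_induct)
  case base
  show ?case by (rule exI[of _ "{}"]) simp
next
  case (step y z)
  then obtain P where P: "P \<subseteq> E" "finite P" "\<And>w. odd (card {e\<in>P. w \<in> e}) \<longleftrightarrow> (w = u) \<noteq> (w = y)"
    by blast
  have yz: "{y, z} \<in> E" using step by (simp add: adj_def)
  then have "card {y, z} = 2" using assms(2) by (simp add: pairs_def)
  then have ne: "y \<noteq> z" by auto
  have "{e \<in> {{y, z}}. w \<in> e} = (if w = y \<or> w = z then {{y, z}} else {})" for w by auto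
  then have one: "even (card {e \<in> {{y, z}}. w \<in> e}) \<longleftrightarrow> \<not> (w = y \<or> w = z)" for w by simp
  \<comment> \<open>Adding the last edge of the walk modulo 2 moves the odd vertex from
    \<open>y\<close> to \<open>z\<close>.\<close>
  let ?Q = "sym_diff P {{y, z}}"
  have "odd (card {e\<in>?Q. w \<in> e}) \<longleftrightarrow> (w = u) \<noteq> (w = z)" for w
  proof -
    have "even (card {e\<in>?Q. w \<in> e}) \<longleftrightarrow>
        (even (card {e\<in>P. w \<in> e}) \<longleftrightarrow> even (card {e\<in>{{y, z}}. w \<in> e}))"
      using P(2) by (intro even_degree_sym_diff) auto
    moreover have "\<not> (w = y \<and> w = z)" using ne by blast
    ultimately show ?thesis using one[of w] P(3)[of w] by argo
  qed
  moreover have "?Q \<subseteq> E" "finite ?Q" using P yz by auto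
  ultimately show ?case by blast
qed

text \<open>The new edge cancels the two odd degrees of the edge set that a walk from
  \<open>u\<close> to \<open>v\<close> yields.\<close>

lemma circ_through_edge:
  assumes "pairs E" "(u, v) \<in> (adj E)\<^sup>*" "{u, v} \<notin> E" "u \<noteq> v"
  shows "\<exists>C\<subseteq>insert {u, v} E. circ C \<and> {u, v} \<in> C"
proof -
  obtain P where P: "P \<subseteq> E" "finite P" "\<And>w. odd (card {e\<in>P. w \<in> e}) \<longleftrightarrow> (w = u) \<noteq> (w = v)"
    using reach_odd_set[OF assms(2,1)] by blast
  have "{e \<in> insert {u, v} P. w \<in> e} =
      (if w = u \<or> w = v then insert {u, v} {e\<in>P. w \<in> e} else {e\<in>P. w \<in> e})" for w by auto
  then have "even (card {e \<in> insert {u, v} P. w \<in> e})" for w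
    using P assms(3,4) by (auto simp: card_insert_if)
  then have "even_set (insert {u, v} P)" using P(2) by (simp add: even_set_def)
  then show ?thesis using even_set_contains_circ[of "insert {u, v} P" "{u, v}"] P(1) by blast
qed

text \<open>Join \<open>a\<close> to \<open>b\<close> inside \<open>U\<close> and add the two edges
  at \<open>v\<close>. No other edge of this even set contains \<open>v\<close>, so a circuit
  through one of them uses both.\<close>

lemma circ_through_adjacent_edges:
  assumes "pairs E" "conn E U" "v \<notin> U" "a \<in> U" "b \<in> U" "a \<noteq> b" "{v, a} \<in> E" "{v, b} \<in> E"
  shows "\<exists>C\<subseteq>induced E (insert v U). circ C \<and> {v, a} \<in> C \<and> {v, b} \<in> C"
proof -
  have "pairs (induced E U)" using assms(1) induced_subset pairs_subset by blast
  then obtain P where P: "P \<subseteq> induced E U" "finite P"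
      "\<And>w. odd (card {e\<in>P. w \<in> e}) \<longleftrightarrow> (w = a) \<noteq> (w = b)"
    using reach_odd_set[OF conn_reach[OF assms(2,4,5)]] by blast
  have ne: "{v, a} \<noteq> {v, b}" using assms by (metis doubleton_eq_iff)
  have "v \<noteq> a" "v \<noteq> b" using assms by auto
  have vP: "v \<notin> e" if "e \<in> P" for e using that P assms(3) by (auto simp: induced_def)
  let ?T = "{{v, a}, {v, b}}"
  have "{e\<in>?T. w \<in> e} = (if w = v then ?T else if w = a then {{v, a}} else if w = b then {{v, b}} else {})"
    for w using assms by auto
  then have T: "even (card {e\<in>?T. w \<in> e}) \<longleftrightarrow> w \<noteq> a \<and> w \<noteq> b" for w
    using ne \<open>v \<noteq> a\<close> \<open>v \<noteq> b\<close> by auto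
  let ?F = "sym_diff P ?T"
  have "even (card {e\<in>?F. w \<in> e})" for w
  proof -
    have "even (card {e\<in>?F. w \<in> e}) \<longleftrightarrow>
        (even (card {e\<in>P. w \<in> e}) \<longleftrightarrow> even (card {e\<in>?T. w \<in> e}))"
      using P(2) by (intro even_degree_sym_diff) auto
    then show ?thesis using T[of w] P(3)[of w] assms(6) by argo
  qed
  then have "even_set ?F" using P(2) by (simp add: even_set_def)
  moreover have "{v, a} \<in> ?F" "{v, b} \<in> ?F" using vP by auto
  ultimately obtain C where C: "C \<subseteq> ?F" "circ C" "{v, a} \<in> C"
    using even_set_contains_circ[of ?F "{v, a}"] by blast
  have "{v, b} \<in> C"
  proof (rule ccontr)
    assume "{v, b} \<notin> C"
    then have "{e\<in>C. v \<in> e} = {{v, a}}" using C vP by blast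
    then have "card {e\<in>C. v \<in> e} = 1" by simp
    then show False using C(2) by (metis circ_def even_set_def odd_one)
  qed
  moreover have "C \<subseteq> induced E (insert v U)"
    using C(1) P(1) assms by (auto simp: induced_def)
  ultimately show ?thesis using C by blast
qed

text \<open>Two edges at \<open>v\<close> share a circuit because \<open>U - {v}\<close> is
  connected. By \<open>circ_trans\<close> the edges sharing a circuit with \<open>e\<close> are
  closed under adjacency, so connectedness makes them all edges.\<close>

lemma two_conn_common_circ:
  assumes "pairs E" "two_conn E U" "e \<in> induced E U" "g \<in> induced E U"
  shows "\<exists>C\<subseteq>induced E U. circ C \<and> e \<in> C \<and> g \<in> C"
proof -
  have conU: "conn E U" and con: "\<And>v. v \<in> U \<Longrightarrow> conn E (U - {v})"
    using assms(2) by (auto simp: two_conn_def)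
  have adjacent: "\<exists>C\<subseteq>induced E U. circ C \<and> d \<in> C \<and> d' \<in> C"
    if d: "d \<in> induced E U" "d' \<in> induced E U" "v \<in> d" "v \<in> d'" "d \<noteq> d'" for d d' v
  proof -
    obtain a where a: "d = {v, a}" "a \<noteq> v" using pairsE[OF assms(1), of d v] d induced_subset by blast
    obtain b where b: "d' = {v, b}" "b \<noteq> v" using pairsE[OF assms(1), of d' v] d induced_subset by blast
    have v: "v \<in> U" using d by (auto simp: induced_def)
    have "insert v (U - {v}) = U" using v by blast
    then show ?thesis
      using circ_through_adjacent_edges[OF assms(1) con[OF v], of v a b] a b d
      by (auto simp: induced_def)
  qed
  define R where "R = {d \<in> induced E U. \<exists>C\<subseteq>induced E U. circ C \<and> e \<in> C \<and> d \<in> C}"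
  have R_adj: "d' \<in> R" if d: "d \<in> R" "d' \<in> induced E U" "v \<in> d" "v \<in> d'" for d d' v
  proof (cases "d = d'")
    case False
    obtain C where C: "C \<subseteq> induced E U" "circ C" "e \<in> C" "d \<in> C" using d by (auto simp: R_def)
    obtain C' where C': "C' \<subseteq> induced E U" "circ C'" "d \<in> C'" "d' \<in> C'"
      using adjacent[of d d' v] d False by (auto simp: R_def)
    obtain X where "X \<subseteq> C \<union> C'" "circ X" "e \<in> X" "d' \<in> X"
      using circ_trans[OF C(2) C'(2) C(3) C'(4)] C(4) C'(3) by blast
    then show ?thesis using d C C' by (auto simp: R_def)
  qed (use d in simp)
  \<comment> \<open>That \<open>e\<close> lies on any circuit at all comes from an adjacent edge,
    which exists because \<open>U\<close> has a third vertex.\<close>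
  have eR: "e \<in> R"
  proof -
    have "e \<noteq> U"
    proof
      assume "e = U"
      moreover have "card e = 2" using assms(1,3) by (simp add: pairs_def induced_def)
      ultimately show False using assms(2) by (auto simp: two_conn_def card_2_iff)
    qed
    moreover have "e \<subseteq> U" "e \<noteq> {}" using assms(1,3) by (auto simp: pairs_def induced_def)
    ultimately obtain a b where ab: "a \<in> e" "b \<in> U" "b \<notin> e" "{a, b} \<in> E"
      using connD[OF conU, of e] by blast
    then have "{a, b} \<in> induced E U" using \<open>e \<subseteq> U\<close> by (auto simp: induced_def)
    then show ?thesis using adjacent[of e "{a, b}" a] ab assms(3) by (auto simp: R_def)
  qed
  define T where "T = {w\<in>U. \<exists>d\<in>R. w \<in> d}"
  have "T = U"
  proof (rule ccontr)
    assume ne: "T \<noteq> U"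
    have "T \<subseteq> U" by (auto simp: T_def)
    obtain x where "x \<in> e" using assms(1,3) by (fastforce simp: pairs_def induced_def)
    then have "x \<in> T" using assms(3) eR by (auto simp: T_def induced_def)
    then obtain a b where ab: "a \<in> T" "b \<in> U" "b \<notin> T" "{a, b} \<in> E"
      using connD[OF conU \<open>T \<subseteq> U\<close> _ ne] by blast
    then have "{a, b} \<in> induced E U" by (auto simp: T_def induced_def)
    then have "{a, b} \<in> R" using R_adj ab by (auto simp: T_def)
    then show False using ab by (auto simp: T_def)
  qed
  obtain x where x: "x \<in> g" using assms(1,4) by (fastforce simp: pairs_def induced_def)
  then have "x \<in> T" using assms(4) \<open>T = U\<close> by (auto simp: induced_def)
  then have "g \<in> R" using R_adj x assms(4) by (auto simp: T_def)
  then show ?thesis by (auto simp: R_def)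
qed

section \<open>Cuts that no circuit meets in more than two edges\<close>

lemma two_conn_edge_at:
  assumes "two_conn E U" "v \<in> U"
  shows "\<exists>e\<in>induced E U. v \<in> e"
proof -
  have "U \<noteq> {v}" using assms by (auto simp: two_conn_def)
  then obtain b where "b \<in> U" "{v, b} \<in> E"
    using assms connD[of E U "{v}"] by (auto simp: two_conn_def)
  then show ?thesis using assms(2) by (auto simp: induced_def)
qed

lemma two_conn_circ_through_vertices:
  assumes "pairs E" "two_conn E U" "u \<in> U" "v \<in> U"
  shows "\<exists>C\<subseteq>induced E U. circ C \<and> (\<exists>e\<in>C. u \<in> e) \<and> (\<exists>e\<in>C. v \<in> e)"
proof -
  obtain e g where e: "e \<in> induced E U" "u \<in> e" and g: "g \<in> induced E U" "v \<in> g"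
    using two_conn_edge_at[OF assms(2)] assms(3,4) by meson
  show ?thesis using two_conn_common_circ[OF assms(1,2) e(1) g(1)] e(2) g(2) by meson
qed

text \<open>A circuit through \<open>X1\<close> and \<open>X2\<close> would have two edges in each of the disjoint boundaries.\<close>
lemma thin_no_split:
  assumes "pairs E" "thin E D" "H \<subseteq> E" "two_conn H U"
    and "X1 \<subseteq> U" "X2 \<subseteq> U" "X1 \<noteq> {}" "X2 \<noteq> {}" "X1 \<inter> X2 = {}"
    and sep: "\<And>a b. a \<in> X1 \<Longrightarrow> b \<in> X2 \<Longrightarrow> {a, b} \<notin> H"
    and bd: "boundary (induced H U) X1 \<subseteq> D" "boundary (induced H U) X2 \<subseteq> D"
  shows False
proof -
  have pH: "pairs H" using assms(1,3) pairs_subset by blast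
  obtain x1 x2 where x: "x1 \<in> X1" "x2 \<in> X2" using assms by blast
  then obtain C e1 e2 where C: "C \<subseteq> induced H U" "circ C" "e1 \<in> C" "x1 \<in> e1" "e2 \<in> C" "x2 \<in> e2"
    using two_conn_circ_through_vertices[OF pH assms(4)] assms(5,6) by (meson subsetD)
  have CE: "C \<subseteq> E" using C(1) assms(3) induced_subset by blast
  have pC: "pairs C" using assms(1) CE pairs_subset by blast
  have "\<not> e2 \<subseteq> X1" "\<not> e1 \<subseteq> X2" using C x assms(9) by auto
  then have c: "card (boundary C X1) \<ge> 2" "card (boundary C X2) \<ge> 2"
    using circ_boundary[OF pC C(2), of e1 X1 e2] circ_boundary[OF pC C(2), of e2 X2 e1] C x by auto
  have disj: "boundary C X1 \<inter> boundary C X2 = {}"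
  proof (rule equals0I)
    fix d assume d: "d \<in> boundary C X1 \<inter> boundary C X2"
    then obtain a b where ab: "a \<in> d" "a \<in> X1" "b \<in> d" "b \<in> X2" by (auto simp: boundary_def)
    then have "a \<noteq> b" using assms(9) by blast
    have dC: "d \<in> C" using d by (simp add: boundary_def)
    obtain w where "d = {a, w}" using pairsE[OF pC dC ab(1)] by blast
    then have "d = {a, b}" using ab \<open>a \<noteq> b\<close> by auto
    then show False using sep[OF ab(2,4)] dC C(1) by (auto simp: induced_def)
  qed
  have fin: "finite C" by (rule circ_finite[OF C(2)])
  then have "card (boundary C X1 \<union> boundary C X2) \<ge> 4"
    using c disj by (subst card_Un_disjoint) (auto simp: boundary_def)
  moreover have "boundary C X1 \<union> boundary C X2 \<subseteq> C \<inter> D"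
    using bd C(1) by (auto simp: boundary_def)
  ultimately have "card (C \<inter> D) \<ge> 4" using fin by (meson card_mono finite_Int le_trans)
  moreover have "card (C \<inter> D) \<le> 2" using assms(2) CE C(2) by (simp add: thin_def)
  ultimately show False by simp
qed

text \<open>If \<open>X Int U\<close> fell into two parts with no edge between them, every edge of
  the graph on \<open>U\<close> leaving a part would lie in the cut, against
  \<open>thin_no_split\<close>.\<close>

lemma thin_side_conn:
  assumes "pairs E" "thin E (boundary E X)" "two_conn E U" "X \<inter> U \<noteq> {}"
  shows "conn E (X \<inter> U)"
  unfolding conn_def
proof (intro conjI allI impI)
  fix Y assume Y: "Y \<subseteq> X \<inter> U" "Y \<noteq> {}" "Y \<noteq> X \<inter> U"
  show "\<exists>a\<in>Y. \<exists>b\<in>X \<inter> U - Y. {a, b} \<in> E"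
  proof (rule ccontr)
    assume no: "\<not> ?thesis"
    have in_bd: "boundary (induced E U) A \<subseteq> boundary E X"
      if A: "A = Y \<or> A = X \<inter> U - Y" for A
    proof
      fix e assume e: "e \<in> boundary (induced E U) A"
      then obtain a where a: "a \<in> e" "a \<in> A" and eE: "e \<in> E" "e \<subseteq> U"
        by (auto simp: boundary_def induced_def)
      obtain b where b: "e = {a, b}" using pairsE[OF assms(1) eE(1) a(1)] by blast
      have "b \<notin> A" using e a b by (auto simp: boundary_def)
      have "b \<notin> X"
      proof
        assume "b \<in> X"
        then have "a \<in> Y \<and> b \<in> X \<inter> U - Y \<or> b \<in> Y \<and> a \<in> X \<inter> U - Y"
          using A a \<open>b \<notin> A\<close> eE(2) b by auto
        moreover have "{a, b} \<in> E" "{b, a} \<in> E" using eE b by (auto simp: insert_commute)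
        ultimately show False using no by blast
      qed
      then show "e \<in> boundary E X" using a A Y b eE by (auto simp: boundary_def)
    qed
    show False
    proof (rule thin_no_split[OF assms(1,2) order_refl assms(3)])
      show "boundary (induced E U) Y \<subseteq> boundary E X"
        "boundary (induced E U) (X \<inter> U - Y) \<subseteq> boundary E X" using in_bd by blast+
      show "{a, b} \<notin> E" if "a \<in> Y" "b \<in> X \<inter> U - Y" for a b using no that by blast
    qed (use Y in auto)
  qed
qed (rule assms(4))

lemma three_conn_conn:
  assumes "three_conn E V" "a \<in> V" "b \<in> V"
  shows "conn E V" "conn E (V - {a})" "conn E (V - {a} - {b})"
  using assms unfolding three_conn_def two_conn_def by (auto, cases "a = b") auto

text \<open>Every vertex has degree at least three: deleting the other ends of two edges that cover
  the star would isolate \<open>v\<close>.\<close>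

lemma three_conn_degree:
  assumes "three_conn E V" "pairs E" "E \<subseteq> Pow V" "v \<in> V"
  shows "\<not> {e\<in>E. v \<in> e} \<subseteq> {d1, d2}"
proof
  assume sub: "{e\<in>E. v \<in> e} \<subseteq> {d1, d2}"
  obtain x y z where xyz: "x \<in> V - {v}" "y \<in> V - {v}" "z \<in> V - {v}" "x \<noteq> y" "x \<noteq> z" "y \<noteq> z"
    using assms(1,4) unfolding three_conn_def two_conn_def by meson
  \<comment> \<open>If \<open>d\<close> is not an edge at \<open>v\<close>, any further vertex
    serves as a placeholder.\<close>
  have other: "\<exists>a\<in>V - {v}. d \<in> E \<longrightarrow> v \<in> d \<longrightarrow> d = {v, a}" for d
  proof (cases "d \<in> E \<and> v \<in> d")
    case True
    then obtain a where "d = {v, a}" "a \<noteq> v" using pairsE[OF assms(2)] by metis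
    then show ?thesis using assms(3) True by blast
  qed (use xyz in blast)
  obtain a b where a: "a \<in> V - {v}" "d1 \<in> E \<longrightarrow> v \<in> d1 \<longrightarrow> d1 = {v, a}"
    and b: "b \<in> V - {v}" "d2 \<in> E \<longrightarrow> v \<in> d2 \<longrightarrow> d2 = {v, b}"
    using other by meson
  have "conn E (V - {a} - {b})" using three_conn_conn[OF assms(1)] a b by blast
  moreover have "{v} \<subseteq> V - {a} - {b}" using a b assms(4) by blast
  moreover have "{v} \<noteq> V - {a} - {b}" using xyz by blast
  ultimately obtain c where c: "c \<in> V - {a} - {b}" "c \<noteq> v" "{v, c} \<in> E"
    using connD[of E "V - {a} - {b}" "{v}"] by blast
  then have "{v, c} = d1 \<or> {v, c} = d2" using sub by blast
  then have "{v, c} = {v, a} \<or> {v, c} = {v, b}" using a b c by blast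
  then show False using c by (auto simp: doubleton_eq_iff)
qed

text \<open>Two boundary edges at \<open>v\<close> keep the graph 2-connected after \<open>v\<close> is detached from the rest of \<open>X\<close>,
  so that \<open>X\<close> falls apart.\<close>
lemma thin_boundary_matching:
  assumes "three_conn E V" "pairs E" "E \<subseteq> Pow V"
    and "thin E (boundary E X)" "X \<subseteq> V" "v \<in> X" "X \<noteq> {v}"
    and d: "d1 \<in> boundary E X" "d2 \<in> boundary E X" "v \<in> d1" "v \<in> d2"
  shows "d1 = d2"
proof (rule ccontr)
  assume ne: "d1 \<noteq> d2"
  have v: "v \<in> V" using assms by blast
  have E: "d1 \<in> E" "d2 \<in> E" using d by (auto simp: boundary_def)
  obtain a1 where a1: "d1 = {v, a1}" "a1 \<noteq> v" using pairsE[OF assms(2) E(1) d(3)] by blast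
  obtain a2 where a2: "d2 = {v, a2}" "a2 \<noteq> v" using pairsE[OF assms(2) E(2) d(4)] by blast
  have aX: "a1 \<notin> X" "a2 \<notin> X" using d a1 a2 assms(6) by (auto simp: boundary_def)
  have aV: "a1 \<in> V" "a2 \<in> V" using assms(3) E a1 a2 by auto
  have "a1 \<noteq> a2" using ne a1 a2 by auto
  define H where "H = E - {e. v \<in> e \<and> e \<subseteq> X}"
  have dH: "{v, a1} \<in> H" "{v, a2} \<in> H" using E a1 a2 aX by (auto simp: H_def)
  have c0: "conn H (V - {v} - S)" if "conn E (V - {v} - S)" for S
    by (rule conn_mono[OF that]) (auto simp: H_def)
  have c1: "conn H (V - {v})" using c0[of "{}"] three_conn_conn[OF assms(1) v v] by simp
  have "conn H ({v} \<union> (V - {v}))"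
    using conn_Un[OF conn_singleton c1 _ _ dH(1)] aV a1 by blast
  moreover have "{v} \<union> (V - {v}) = V" using v by blast
  ultimately have cV: "conn H V" by simp
  have cw: "conn H (V - {w})" if w: "w \<in> V" for w
  proof (cases "w = v")
    case False
    \<comment> \<open>One of the two boundary edges survives the deletion of \<open>w\<close> and
      attaches \<open>v\<close> to the connected rest.\<close>
    obtain a where a: "a \<in> V" "a \<noteq> v" "a \<noteq> w" "{v, a} \<in> H"
      using aV a1 a2 dH \<open>a1 \<noteq> a2\<close> by metis
    have "conn H (V - {v} - {w})" using c0 three_conn_conn[OF assms(1) v w] by blast
    then have "conn H ({v} \<union> (V - {v} - {w}))"
      using conn_Un[OF conn_singleton _ _ _ a(4)] a by blast
    moreover have "{v} \<union> (V - {v} - {w}) = V - {w}" using v False by blast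
    ultimately show ?thesis by simp
  qed (use c1 in simp)
  have "\<exists>a\<in>V. \<exists>b\<in>V. \<exists>c\<in>V. a \<noteq> b \<and> a \<noteq> c \<and> b \<noteq> c"
    using assms(1) by (simp add: three_conn_def two_conn_def)
  then have H2: "two_conn H V" using cV cw by (simp add: two_conn_def)
  have HE: "H \<subseteq> E" by (auto simp: H_def)
  show False
  proof (rule thin_no_split[OF assms(2,4) HE H2])
    show "boundary (induced H V) {v} \<subseteq> boundary E X"
      using assms(6) by (auto simp: boundary_def induced_def H_def)
    show "boundary (induced H V) (X - {v}) \<subseteq> boundary E X"
      by (auto simp: boundary_def induced_def H_def)
    show "{a, b} \<notin> H" if "a \<in> {v}" "b \<in> X - {v}" for a b
      using that assms(6) by (auto simp: H_def)
  qed (use assms in auto)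
qed

lemma boundary_Compl:
  assumes "E \<subseteq> Pow V"
  shows "boundary E (V - X) = boundary E X"
  using assms by (fastforce simp: boundary_def)

text \<open>The boundary \<open>boundary E X\<close> contains two disjoint edges on one side of \<open>Z\<close>. Together with the
  2-connected graphs induced by \<open>X\<close> and \<open>V - X\<close> they form a 2-connected graph
  in which \<open>Z\<close> falls apart.\<close>
lemma thin_boundaries_not_crossing:
  assumes tc: "three_conn E V" and pE: "pairs E" and EV: "E \<subseteq> Pow V"
    and thX: "thin E (boundary E X)" and thZ: "thin E (boundary E Z)" and "X \<subseteq> V" "Z \<subseteq> V"
    and g: "g \<in> boundary E Z" "g \<subseteq> X" and h: "h \<in> boundary E Z" "h \<subseteq> V - X"
  shows False
proof -
  have tw: "two_conn E V" "\<And>v. v \<in> V \<Longrightarrow> two_conn E (V - {v})"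
    using tc by (auto simp: three_conn_def)
  define Y where "Y = V - X"
  define W where "W = V - Z"
  have bdY: "boundary E Y = boundary E X" unfolding Y_def by (rule boundary_Compl[OF EV])
  have bdW: "boundary E W = boundary E Z" unfolding W_def by (rule boundary_Compl[OF EV])
  have YV: "Y \<subseteq> V" and WV: "W \<subseteq> V" by (auto simp: Y_def W_def)
  have "g \<inter> Z \<noteq> {}" "\<not> g \<subseteq> Z" "h \<inter> Z \<noteq> {}" "\<not> h \<subseteq> Z"
    using g(1) h(1) by (simp_all add: boundary_def)
  then obtain g1 g2 h1 h2 where "g1 \<in> g" "g1 \<in> Z" "g2 \<in> g" "g2 \<notin> Z"
    "h1 \<in> h" "h1 \<in> Z" "h2 \<in> h" "h2 \<notin> Z" by blast
  then have g12: "g1 \<in> X" "g1 \<in> Z" "g2 \<in> X" "g2 \<in> W"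
    and h12: "h1 \<in> Y" "h1 \<in> Z" "h2 \<in> Y" "h2 \<in> W"
    using g(2) h(2) assms(6) unfolding W_def Y_def by blast+
  have ne: "g1 \<noteq> g2" "h1 \<noteq> h2" using g12 h12 by (auto simp: W_def)
  note match = thin_boundary_matching[OF tc pE EV]
  have cW: "conn E W"
    using thin_side_conn[OF pE _ tw(1), of W] thZ g12 WV by (auto simp: bdW Int_absorb2)
  \<comment> \<open>\<open>g\<close> and \<open>h\<close> cross the cut of \<open>Z\<close>, so
    \<open>W\<close> has vertices in both \<open>X\<close> and \<open>Y\<close>; as \<open>W\<close>
    is connected, it contains an edge of the cut of \<open>X\<close>.\<close>
  have "X \<inter> W \<noteq> {}" "X \<inter> W \<noteq> W" using g12 h12 by (auto simp: Y_def)
  from connD[OF cW Int_lower2 this]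
  obtain a b where "a \<in> X \<inter> W" "b \<in> W" "b \<notin> X \<inter> W" "{a, b} \<in> E" by blast
  then have ab: "a \<in> X" "a \<in> W" "b \<in> W" "b \<in> Y" "{a, b} \<in> E"
    using WV unfolding Y_def by blast+
  have abX: "{a, b} \<in> boundary E X" using ab by (auto simp: boundary_def Y_def)
  \<comment> \<open>Otherwise each edge at \<open>a\<close> crosses one of the two cuts. Each cut
    has at most one edge at \<open>a\<close>, so \<open>a\<close> would have degree at most
    two.\<close>
  have "X \<inter> W \<noteq> {a}"
  proof
    assume Xa: "X \<inter> W = {a}"
    obtain d where d: "{e \<in> boundary E Z. a \<in> e} \<subseteq> {d}"
    proof (cases "{e \<in> boundary E Z. a \<in> e} = {}")
      case False
      then obtain d where "d \<in> boundary E Z" "a \<in> d" by blast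
      moreover have "W \<noteq> {a}" using ab by (auto simp: Y_def)
      ultimately have "e = d" if "e \<in> boundary E Z" "a \<in> e" for e
        using match[of W a e d] thZ WV ab(2) that by (simp add: bdW)
      then show thesis using that by blast
    qed (use that in blast)
    have "{e\<in>E. a \<in> e} \<subseteq> {{a, b}, d}"
    proof
      fix e assume e: "e \<in> {e\<in>E. a \<in> e}"
      then obtain c where c: "e = {a, c}" "c \<noteq> a" using pairsE[OF pE] by blast
      have cV: "c \<in> V" using EV e c by blast
      show "e \<in> {{a, b}, d}"
      proof (cases "c \<in> X")
        case True
        then have "c \<in> Z" using Xa c cV by (auto simp: W_def)
        then have "e \<in> boundary E Z" using e c ab by (auto simp: boundary_def W_def)
        then show ?thesis using d e by blast
      next
        case False
        then have "e \<in> boundary E X" using e c ab by (auto simp: boundary_def)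
        moreover have "X \<noteq> {a}" using g12 ab by (auto simp: W_def)
        ultimately show ?thesis using match[OF thX assms(6) ab(1), of e "{a, b}"] abX e by auto
      qed
    qed
    moreover have "a \<in> V" using ab(2) WV by blast
    ultimately show False using three_conn_degree[OF tc pE EV, of a "{a, b}" d] by simp
  qed
  \<comment> \<open>Repeating the argument in \<open>W - {a}\<close> gives a second edge, which the
    matching property makes disjoint from the first.\<close>
  have cWa: "conn E (W - {a})"
  proof -
    have "W \<inter> (V - {a}) = W - {a}" using WV by blast
    moreover have "b \<in> W - {a}" using ab by (auto simp: Y_def)
    ultimately show ?thesis
      using thin_side_conn[OF pE, of W "V - {a}"] thZ tw(2) ab WV by (auto simp: bdW)
  qed
  have "X \<inter> W - {a} \<subseteq> W - {a}" "X \<inter> W - {a} \<noteq> {}"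
    using \<open>X \<inter> W \<noteq> {a}\<close> ab by blast+
  moreover have "X \<inter> W - {a} \<noteq> W - {a}" using ab by (auto simp: Y_def)
  ultimately obtain a' b' where
    "a' \<in> X \<inter> W - {a}" "b' \<in> W - {a}" "b' \<notin> X \<inter> W - {a}" "{a', b'} \<in> E"
    using connD[OF cWa] by blast
  then have ab': "a' \<in> X" "a' \<in> W" "a' \<noteq> a" "b' \<in> W" "b' \<in> Y" "{a', b'} \<in> E"
    using WV unfolding Y_def by blast+
  have abX': "{a', b'} \<in> boundary E X" using ab' by (auto simp: boundary_def Y_def)
  have "b' \<noteq> b"
  proof
    assume "b' = b"
    moreover have "Y \<noteq> {b}" using h12 ab by (auto simp: W_def)
    ultimately have "{a, b} = {a', b'}"
      using match[of Y b "{a, b}" "{a', b'}"] thX YV ab(4) abX abX' by (simp add: bdY)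
    then show False using ab ab' by (auto simp: doubleton_eq_iff Y_def)
  qed
  \<comment> \<open>Of the cut of \<open>X\<close> only the two edges inside \<open>W\<close> are
    kept, so no edge of \<open>H\<close> joins \<open>X Int Z\<close> to
    \<open>Y Int Z\<close>.\<close>
  define H where "H = induced E X \<union> induced E Y \<union> {{a, b}, {a', b'}}"
  have cside: "conn H A" "\<And>v. v \<in> V \<Longrightarrow> conn H (A - {v})" if A: "A = X \<or> A = Y" for A
  proof -
    have A': "A \<subseteq> V" "thin E (boundary E A)" "\<And>v. A - {v} \<noteq> {}" "A \<noteq> {}"
      using A assms(6) YV thX g12 h12 ne by (auto simp: bdY)
    have mono: "conn H B" if "conn E B" "B \<subseteq> A" for B
      by (rule conn_mono[OF that(1)]) (use A that(2) in \<open>auto simp: H_def induced_def\<close>)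
    have "conn E A" using thin_side_conn[OF pE A'(2) tw(1)] A' by (auto simp: Int_absorb2)
    then show "conn H A" using mono by blast
    show "conn H (A - {v})" if v: "v \<in> V" for v
    proof -
      have "A \<inter> (V - {v}) = A - {v}" using A' by blast
      then have "conn E (A - {v})"
        using thin_side_conn[OF pE A'(2) tw(2)[OF v]] A'(3) by simp
      then show ?thesis using mono by blast
    qed
  qed
  have VXY: "V = X \<union> Y" using assms(6) by (auto simp: Y_def)
  have abH: "{a, b} \<in> H" "{a', b'} \<in> H" by (auto simp: H_def)
  have "conn H V" unfolding VXY using conn_Un[OF cside(1) cside(1) ab(1,4) abH(1)] by blast
  \<comment> \<open>Since the two cross edges are disjoint, one of them survives the deletion of
    \<open>v\<close> and links the two connected sides.\<close>
  moreover have "conn H (V - {v})" if v: "v \<in> V" for v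
  proof -
    have "a \<noteq> b'" "a' \<noteq> b" using ab ab' by (auto simp: Y_def)
    then obtain x y where "x \<in> X - {v}" "y \<in> Y - {v}" "{x, y} \<in> H"
      using ab ab' abH \<open>b' \<noteq> b\<close> by (metis DiffI singletonD)
    then have "conn H ((X - {v}) \<union> (Y - {v}))"
      using conn_Un[OF cside(2)[OF _ v] cside(2)[OF _ v]] by blast
    then show ?thesis unfolding VXY by (simp add: Un_Diff)
  qed
  moreover have "\<exists>a\<in>V. \<exists>b\<in>V. \<exists>c\<in>V. a \<noteq> b \<and> a \<noteq> c \<and> b \<noteq> c"
    using tw(1) by (simp add: two_conn_def)
  ultimately have H2: "two_conn H V" by (simp add: two_conn_def)
  have HE: "H \<subseteq> E" using ab ab' by (auto simp: H_def induced_def)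
  show False
  proof (rule thin_no_split[OF pE thZ HE H2])
    have ZW: "Z \<inter> W = {}" and XY: "X \<inter> Y = {}" by (auto simp: W_def Y_def)
    show "{x, y} \<notin> H" if "x \<in> X \<inter> Z" "y \<in> Y \<inter> Z" for x y
      using that ab ab' ZW XY by (auto simp: H_def induced_def doubleton_eq_iff Y_def)
    have bd: "boundary (induced H V) (A \<inter> Z) \<subseteq> boundary E Z" if A: "A = X \<or> A = Y" for A
    proof
      fix e assume e: "e \<in> boundary (induced H V) (A \<inter> Z)"
      then have eH: "e \<in> H" "e \<inter> (A \<inter> Z) \<noteq> {}" "\<not> e \<subseteq> A \<inter> Z"
        by (auto simp: boundary_def induced_def)
      have "\<not> e \<subseteq> Z"
        using eH A XY ZW ab ab' by (auto simp: H_def induced_def)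
      then show "e \<in> boundary E Z" using eH HE by (auto simp: boundary_def)
    qed
    show "boundary (induced H V) (X \<inter> Z) \<subseteq> boundary E Z"
      "boundary (induced H V) (Y \<inter> Z) \<subseteq> boundary E Z" using bd by blast+
  qed (use assms(6) YV g12 h12 in \<open>auto simp: Y_def\<close>)
qed

section \<open>From connection by paths to connection by cuts\<close>

lemma graph_connected_conn:
  assumes "graph_connected (V - S) {e\<in>E. e \<inter> S = {}}"
  shows "conn E (V - S)"
proof (rule reach_conn)
  show "V - S \<noteq> {}" using assms by (simp add: graph_connected_def)
  fix u v assume uv: "u \<in> V - S" "v \<in> V - S"
  have "\<exists>ps. ps \<noteq> [] \<and> hd ps = u \<and> last ps = v \<and> set ps \<subseteq> V - S \<and>
      (\<forall>i. i + 1 < length ps \<longrightarrow> {ps ! i, ps ! (i + 1)} \<in> {e\<in>E. e \<inter> S = {}})"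
    using assms uv by (simp only: graph_connected_def)
  then obtain ps where ps: "ps \<noteq> []" "hd ps = u" "last ps = v" "set ps \<subseteq> V - S"
    "\<forall>i. i + 1 < length ps \<longrightarrow> {ps ! i, ps ! (i + 1)} \<in> {e\<in>E. e \<inter> S = {}}"
    by (elim exE conjE) rule
  have "(ps ! 0, ps ! i) \<in> (adj (induced E (V - S)))\<^sup>*" if "i < length ps" for i
    using that
  proof (induction i)
    case (Suc i)
    have "ps ! i \<in> V - S" "ps ! Suc i \<in> V - S" using ps(4) Suc.prems by (auto simp: subset_iff)
    then have "(ps ! i, ps ! Suc i) \<in> adj (induced E (V - S))"
      using ps(5)[rule_format, of i] Suc.prems by (simp add: adj_def induced_def)
    then show ?case using Suc by (meson Suc_lessD rtrancl.rtrancl_into_rtrancl)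
  qed simp
  then show "(u, v) \<in> (adj (induced E (V - S)))\<^sup>*"
    using ps(1-3) by (metis hd_conv_nth last_conv_nth diff_less length_greater_0_conv zero_less_one)
qed

lemma k_connected_three_conn:
  assumes "k_connected 3 V E"
  shows "three_conn E V"
proof -
  have c: "conn E (V - S)" if "S \<subseteq> V" "finite S" "card S < 3" for S
    using assms that by (auto simp: k_connected_def intro: graph_connected_conn)
  have "conn E V" using c[of "{}"] by simp
  moreover have "conn E (V - {v})" if "v \<in> V" for v using c[of "{v}"] that by simp
  moreover have "conn E (V - {v} - {w})" if "v \<in> V" "w \<in> V" for v w
  proof -
    have "V - {v} - {w} = V - {v, w}" by blast
    moreover have "card {v, w} < 3" by (cases "v = w") auto
    ultimately show ?thesis using c[of "{v, w}"] that by simp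
  qed
  \<comment> \<open>More than three vertices leave the three that \<open>two_conn\<close> demands
    even after one deletion.\<close>
  moreover have three: "\<exists>a\<in>V - R. \<exists>b\<in>V - R. \<exists>c\<in>V - R. a \<noteq> b \<and> a \<noteq> c \<and> b \<noteq> c"
    if "finite R" "card R \<le> 1" for R
  proof -
    have "infinite V \<or> card V \<ge> 4" using assms by (auto simp: k_connected_def)
    then obtain T where T: "T \<subseteq> V" "finite T" "card T = 4"
      by (metis infinite_arbitrarily_large obtain_subset_with_card_n)
    have "card (T - R) \<ge> 3" using diff_card_le_card_Diff[OF that(1), of T] T that(2) by linarith
    then obtain T' where T': "T' \<subseteq> T - R" "card T' = 3" by (metis obtain_subset_with_card_n)
    then obtain a b c where "T' = {a, b, c}" "a \<noteq> b" "b \<noteq> c" "a \<noteq> c" by (auto simp: card_3_iff)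
    then have "a \<in> V - R" "b \<in> V - R" "c \<in> V - R" using T'(1) T(1) by blast+
    then show ?thesis using \<open>a \<noteq> b\<close> \<open>b \<noteq> c\<close> \<open>a \<noteq> c\<close> by metis
  qed
  ultimately show ?thesis
    unfolding three_conn_def two_conn_def using three[of "{}"] three[of "{v}" for v] by simp
qed

section \<open>Preimages of vertex stars\<close>

lemma even_le_two: "even n \<Longrightarrow> n \<le> 2 \<Longrightarrow> n = 0 \<or> n = (2::nat)"
  by presburger

text \<open>\<open>X\<close> collects the vertices reachable without \<open>D\<close> from one end
  of an edge \<open>e\<close> of \<open>D\<close>. Its boundary lies in \<open>D\<close>, and the
  other end of \<open>e\<close> is outside \<open>X\<close>, since otherwise a circuit would meet
  \<open>D\<close> in \<open>e\<close> alone. On a circuit through \<open>e\<close> and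
  \<open>g\<close> in \<open>D\<close>, the boundary is a nonempty even subset of a two-element set,
  so it contains \<open>g\<close>.\<close>

lemma zero_two_set_is_boundary:
  assumes "pairs E" "two_conn E V" "E \<subseteq> Pow V" "D \<subseteq> E" "D \<noteq> {}"
    and D: "\<And>C. C \<subseteq> E \<Longrightarrow> circ C \<Longrightarrow> card (C \<inter> D) = 0 \<or> card (C \<inter> D) = 2"
  shows "\<exists>X\<subseteq>V. D = boundary E X"
proof -
  obtain e where e: "e \<in> D" using assms(5) by blast
  then have "card e = 2" using assms(1,4) by (auto simp: pairs_def)
  then obtain a b where ab: "e = {a, b}" "a \<noteq> b" by (auto simp: card_2_iff)
  have indV: "induced E V = E" using assms(3) by (auto simp: induced_def)
  define X where "X = {w\<in>V. (a, w) \<in> (adj (E - D))\<^sup>*}"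
  have aX: "a \<in> X" using e ab assms(3,4) by (auto simp: X_def)
  have bX: "b \<notin> X"
  proof
    assume "b \<in> X"
    then have "(a, b) \<in> (adj (E - D))\<^sup>*" by (simp add: X_def)
    moreover have "pairs (E - D)" using assms(1) by (auto simp: pairs_def)
    ultimately obtain C where C: "C \<subseteq> insert {a, b} (E - D)" "circ C" "{a, b} \<in> C"
      using circ_through_edge[of "E - D" a b] e ab by blast
    then have "C \<inter> D = {{a, b}}" using e ab by blast
    then have "card (C \<inter> D) = 1" by simp
    moreover have "C \<subseteq> E" using C(1) e ab assms(4) by blast
    ultimately show False using D[OF _ C(2)] by simp
  qed
  have bdD: "boundary E X \<subseteq> D"
  proof
    fix g assume g: "g \<in> boundary E X"
    then have gE: "g \<in> E" by (simp add: boundary_def)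
    obtain c where c: "c \<in> g" "c \<in> X" using g by (auto simp: boundary_def)
    obtain d where d: "g = {c, d}" using pairsE[OF assms(1) gE c(1)] by blast
    have dX: "d \<in> V" "d \<notin> X" using g d c assms(3) by (auto simp: boundary_def)
    show "g \<in> D"
    proof (rule ccontr)
      assume "g \<notin> D"
      then have "(c, d) \<in> adj (E - D)" using gE d by (simp add: adj_def)
      then have "d \<in> X" using c dX by (auto simp: X_def intro: rtrancl_into_rtrancl)
      then show False using dX by blast
    qed
  qed
  have "g \<in> boundary E X" if g: "g \<in> D" for g
  proof -
    obtain C where C: "C \<subseteq> E" "circ C" "e \<in> C" "g \<in> C"
      using two_conn_common_circ[OF assms(1,2), of e g] e g assms(4) unfolding indV by auto
    have pC: "pairs C" using assms(1) C(1) pairs_subset by blast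
    have sub: "boundary C X \<subseteq> C \<inter> D" using bdD C(1) by (auto simp: boundary_def)
    have eb: "e \<in> boundary C X" using aX bX ab C(3) by (auto simp: boundary_def)
    have fin: "finite (C \<inter> D)" using circ_finite[OF C(2)] by simp
    have "card (C \<inter> D) = 2" using D[OF C(1,2)] fin e C(3) by auto
    moreover have "card (boundary C X) \<noteq> 0" using eb sub fin by (metis card_0_eq empty_iff finite_subset)
    moreover have "even (card (boundary C X))" by (rule even_boundary[OF pC circ_even_set[OF C(2)]])
    moreover have "card (boundary C X) \<le> card (C \<inter> D)" by (rule card_mono[OF fin sub])
    ultimately have "card (boundary C X) = card (C \<inter> D)" using even_le_two by metis
    then have "boundary C X = C \<inter> D" using card_subset_eq[OF fin sub] by blast
    then show ?thesis using g C by (auto simp: boundary_def)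
  qed
  then have "D = boundary E X" using bdD by blast
  moreover have "X \<subseteq> V" by (auto simp: X_def)
  ultimately show ?thesis by blast
qed

text \<open>If the cut \<open>D x\<close> is no star, both its sides contain edges, and a circuit
  through an edge of each produces a second cut \<open>D z\<close> that crosses it.\<close>

lemma star_preimage:
  assumes pE: "pairs E" and EV: "E \<subseteq> Pow V" and tc: "three_conn E V"
    and inj: "inj_on f E" and pf: "pairs (f ` E)"
    and pres: "\<And>C. C \<subseteq> E \<Longrightarrow> circ C \<Longrightarrow> circ (f ` C)"
    and deg: "\<And>C v. C \<subseteq> E \<Longrightarrow> circ C \<Longrightarrow> card {e \<in> f ` C. v \<in> e} \<le> 2"
    and ex: "{e\<in>E. x \<in> f e} \<noteq> {}"
  shows "\<exists>v\<in>V. {e\<in>E. x \<in> f e} = {e\<in>E. v \<in> e}"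
proof (rule ccontr)
  assume nostar: "\<not> ?thesis"
  have tw: "two_conn E V" using tc by (simp add: three_conn_def)
  have indV: "induced E V = E" using EV by (auto simp: induced_def)
  define D where "D z = {e\<in>E. z \<in> f e}" for z
  \<comment> \<open>By injectivity the intersection has as many edges as the image circuit has at
    \<open>z\<close>, an even number at most two.\<close>
  have D02: "card (C \<inter> D z) = 0 \<or> card (C \<inter> D z) = 2" if C: "C \<subseteq> E" "circ C" for C z
  proof -
    have "f ` (C \<inter> D z) = {e \<in> f ` C. z \<in> e}" using C by (auto simp: D_def)
    moreover have "inj_on f (C \<inter> D z)" using inj C by (meson inf.coboundedI1 inj_on_subset)
    ultimately have "card (C \<inter> D z) = card {e \<in> f ` C. z \<in> e}" by (metis card_image)
    moreover have "even (card {e \<in> f ` C. z \<in> e})"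
      using pres[OF C] by (simp add: circ_def even_set_def)
    ultimately show ?thesis using deg[OF C, of z] even_le_two by metis
  qed
  have thin: "thin E (D z)" for z
    using D02 unfolding thin_def by (metis le_refl zero_le)
  have bond: "\<exists>Z\<subseteq>V. D z = boundary E Z" if "D z \<noteq> {}" for z
    using zero_two_set_is_boundary[OF pE tw EV _ that D02] by (auto simp: D_def)
  obtain X where X: "X \<subseteq> V" "D x = boundary E X" using bond[of x] ex by (auto simp: D_def)
  have bdY: "boundary E (V - X) = boundary E X" by (rule boundary_Compl[OF EV])
  have singleton: "boundary E {v} = {e\<in>E. v \<in> e}" for v
  proof -
    have "\<not> e \<subseteq> {v}" if "e \<in> E" for e
    proof
      assume "e \<subseteq> {v}"
      then have "card e \<le> card {v}" by (intro card_mono) auto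
      then show False using pE that by (simp add: pairs_def)
    qed
    then show ?thesis by (auto simp: boundary_def)
  qed
  \<comment> \<open>A one-vertex side would make \<open>D x\<close> a star; a larger side is
    connected and so contains an edge.\<close>
  have edge_in: "\<exists>g\<in>E. g \<subseteq> A" if A: "A = X \<or> A = V - X" for A
  proof -
    have bdA: "D x = boundary E A" using A X bdY by auto
    have "boundary E A \<noteq> {}" using ex unfolding bdA[symmetric] D_def .
    then obtain v where v: "v \<in> A" by (auto simp: boundary_def)
    have AV: "A \<subseteq> V" using A X by blast
    have "A \<noteq> {v}" using nostar bdA singleton v AV by (auto simp: D_def)
    moreover have "conn E (A \<inter> V)"
      using thin_side_conn[OF pE _ tw, of A] thin[of x] bdA v AV by auto
    moreover have "A \<inter> V = A" using AV by blast
    ultimately obtain w where "w \<in> A" "{v, w} \<in> E" using connD[of E A "{v}"] v by auto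
    then show ?thesis using v by (intro bexI[of _ "{v, w}"]) auto
  qed
  obtain g0 h0 where gh0: "g0 \<in> E" "g0 \<subseteq> X" "h0 \<in> E" "h0 \<subseteq> V - X"
    using edge_in[of X] edge_in[of "V - X"] by blast
  obtain C where C: "C \<subseteq> E" "circ C" "g0 \<in> C" "h0 \<in> C"
    using two_conn_common_circ[OF pE tw, of g0 h0] gh0 unfolding indV by auto
  text \<open>Going around the circuit \<open>f ` C\<close>, images of edges inside \<open>X\<close> must meet images of edges
    inside \<open>V - X\<close> in a vertex other than \<open>x\<close>.\<close>
  have "\<exists>z g h. z \<noteq> x \<and> g \<in> D z \<and> g \<subseteq> X \<and> h \<in> D z \<and> h \<subseteq> V - X"
  proof (rule ccontr)
    assume "\<not> ?thesis"
    then have no: "False" if "z \<noteq> x" "g \<in> D z" "g \<subseteq> X" "h \<in> D z" "h \<subseteq> V - X" for z g h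
      using that by blast
    define K where "K = {z. z \<noteq> x \<and> (\<exists>e\<in>C. e \<subseteq> X \<and> z \<in> f e)}"
    have pfC: "pairs (f ` C)" by (rule pairs_subset[OF pf image_mono[OF C(1)]])
    \<comment> \<open>The image of an edge inside \<open>X\<close> can leave \<open>K\<close> only
      at \<open>x\<close>, and by \<open>no\<close> the image of an edge inside \<open>V - X\<close>
      cannot meet \<open>K\<close>. The images of cut edges contain \<open>x\<close>.\<close>
    have leave: "e' = {z, x}" if e': "e' \<in> f ` C" "z \<in> e'" "z \<in> K" "w \<in> e'" "w \<notin> K" for e' z w
    proof -
      obtain e where e: "e \<in> C" "e' = f e" using e'(1) by blast
      obtain e1 where e1: "e1 \<in> C" "e1 \<subseteq> X" "z \<in> f e1" "z \<noteq> x" using e'(3) by (auto simp: K_def)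
      have "x \<in> e'"
      proof (rule ccontr)
        assume "x \<notin> e'"
        then have "e \<notin> boundary E X" using X(2) e by (auto simp: D_def)
        moreover have "\<not> e \<subseteq> X" using e e'(4,5) \<open>x \<notin> e'\<close> by (auto simp: K_def)
        ultimately have "e \<subseteq> V - X" using e C(1) EV by (auto simp: boundary_def)
        then show False
          using no[OF e1(4) _ e1(2), of e] e e1 C(1) e'(2) by (auto simp: D_def)
      qed
      moreover obtain y where "e' = {z, y}" using pairsE[OF pfC e'(1,2)] by blast
      ultimately show ?thesis using e1(4) by auto
    qed
    \<comment> \<open>\<open>T\<close> is even: at \<open>K\<close> it has full degree, at
      \<open>x\<close> its degree is the size of the boundary of \<open>K\<close>, elsewhere zero.
      Hence it is the whole image circuit and contains the image of \<open>h0\<close>, against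
      \<open>no\<close>.\<close>
    define T where "T = {e' \<in> f ` C. e' \<inter> K \<noteq> {}}"
    have xK: "x \<notin> K" by (simp add: K_def)
    have "even (card {e\<in>T. v \<in> e})" for v
    proof -
      consider "v \<in> K" | "v = x" | "v \<notin> K" "v \<noteq> x" by blast
      then show ?thesis
      proof cases
        case 1
        then have "{e\<in>T. v \<in> e} = {e \<in> f ` C. v \<in> e}" by (auto simp: T_def)
        then show ?thesis using pres[OF C(1,2)] by (simp add: circ_def even_set_def)
      next
        case 2
        have "{e\<in>T. v \<in> e} = boundary (f ` C) K"
        proof (intro equalityI subsetI)
          fix e assume "e \<in> {e\<in>T. v \<in> e}"
          then show "e \<in> boundary (f ` C) K" using 2 xK by (auto simp: T_def boundary_def)
        next
          fix e assume e: "e \<in> boundary (f ` C) K"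
          then obtain z w where "e \<in> f ` C" "z \<in> e" "z \<in> K" "w \<in> e" "w \<notin> K"
            unfolding boundary_def by blast
          then show "e \<in> {e\<in>T. v \<in> e}" using leave[of e z w] 2 by (auto simp: T_def)
        qed
        then show ?thesis
          using even_boundary[OF pfC circ_even_set[OF pres[OF C(1,2)]]] by simp
      next
        case 3
        have "{e\<in>T. v \<in> e} = {}"
        proof (rule equals0I)
          fix e assume e: "e \<in> {e\<in>T. v \<in> e}"
          then obtain z where "z \<in> e" "z \<in> K" by (auto simp: T_def)
          then show False using leave[of e z v] e 3 by (auto simp: T_def)
        qed
        then show ?thesis by (metis card.empty even_zero)
      qed
    qed
    then have "even_set T" using circ_finite[OF pres[OF C(1,2)]] by (simp add: even_set_def T_def)
    moreover have "f g0 \<in> T"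
    proof -
      have "g0 \<notin> D x" using X(2) gh0 by (auto simp: boundary_def)
      then have "x \<notin> f g0" using gh0 by (simp add: D_def)
      moreover have "f g0 \<noteq> {}" using pf gh0(1) by (auto simp: pairs_def)
      ultimately have "f g0 \<inter> K \<noteq> {}" using C(3) gh0(2) by (auto simp: K_def)
      then show ?thesis using C(3) by (auto simp: T_def)
    qed
    moreover have "T \<subseteq> f ` C" by (auto simp: T_def)
    ultimately have "T = f ` C" using circ_minimal[OF pres[OF C(1,2)]] by blast
    then have "f h0 \<in> T" using C(4) by blast
    then obtain z e1 where "z \<in> f h0" "z \<noteq> x" "e1 \<in> C" "e1 \<subseteq> X" "z \<in> f e1"
      by (auto simp: T_def K_def)
    then show False using no[of z e1 h0] gh0 C(1) by (auto simp: D_def)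
  qed
  then obtain z g h where z: "g \<in> D z" "g \<subseteq> X" "h \<in> D z" "h \<subseteq> V - X" by blast
  then obtain Z where Z: "Z \<subseteq> V" "D z = boundary E Z" using bond[of z] by blast
  show False
    using thin_boundaries_not_crossing[OF tc pE EV _ _ X(1) Z(1), of g h]
      thin[of x] thin[of z] X(2) Z(2) z by simp
qed

section \<open>The vertex bijection\<close>

theorem theorem1p3:
  fixes V :: "'a set" and E :: "'a set set" and V' :: "'b set" and E' :: "'b set set"
    and f :: "'a set \<Rightarrow> 'b set"
  assumes "simple_graph V E" and "k_connected 3 V E"
    and "simple_graph V' E'" and "no_isolated_vertices V' E'"
    and "\<not> is_circuit V' E' E'"
    and "circuit_surjection V E V' E' f"
  shows "\<exists>\<phi>. bij_betw \<phi> V V' \<and> (\<forall>e\<in>E. f e = \<phi> ` e)"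
proof -
  have pE: "pairs E" by (rule simple_graph_pairs[OF assms(1)])
  have EV: "E \<subseteq> Pow V" using assms(1) by (auto simp: simple_graph_def)
  have pE': "pairs E'" by (rule simple_graph_pairs[OF assms(3)])
  have EV': "E' \<subseteq> Pow V'" using assms(3) by (auto simp: simple_graph_def)
  have tc: "three_conn E V" by (rule k_connected_three_conn[OF assms(2)])
  then have tw: "two_conn E V" and tw': "\<And>v. v \<in> V \<Longrightarrow> two_conn E (V - {v})"
    by (auto simp: three_conn_def)
  have indV: "induced E V = E" using EV by (auto simp: induced_def)
  have fE: "f ` E = E'" using assms(6) by (simp add: circuit_surjection_def)
  have pres': "is_circuit V' E' (f ` C)" if "C \<subseteq> E" "circ C" for C
    using assms(6) that is_circuit_iff[OF assms(1)] by (simp add: circuit_surjection_def)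
  have pres: "circ (f ` C)" if "C \<subseteq> E" "circ C" for C
    using is_circuit_circ(1)[OF pres'[OF that]] .
  have deg: "card {e \<in> f ` C. v \<in> e} \<le> 2" if "C \<subseteq> E" "circ C" for C v
    using is_circuit_circ(3)[OF pres'[OF that]] .
  have inj: "inj_on f E"
  proof (rule circuit_map_inj)
    show "\<exists>C\<subseteq>E. circ C \<and> e \<in> C \<and> g \<in> C" if "e \<in> E" "g \<in> E" for e g
      using two_conn_common_circ[OF pE tw, of e g] that unfolding indV by simp
    \<comment> \<open>Delete an end of \<open>g\<close> that is not on \<open>e\<close>; the rest is
      2-connected and has a circuit through \<open>e\<close>.\<close>
    show "\<exists>C\<subseteq>E. circ C \<and> e \<in> C \<and> g \<notin> C" if eg: "e \<in> E" "g \<in> E" "e \<noteq> g" for e g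
    proof -
      have "card e = 2" "card g = 2" using pE eg by (auto simp: pairs_def)
      then have "\<not> g \<subseteq> e" using eg(3) by (metis card_subset_eq card.infinite zero_neq_numeral)
      then obtain a where a: "a \<in> g" "a \<notin> e" by blast
      then have "a \<in> V" using eg(2) EV by blast
      have "e \<in> induced E (V - {a})" using eg(1) EV a by (auto simp: induced_def)
      then obtain C where "C \<subseteq> induced E (V - {a})" "circ C" "e \<in> C"
        using two_conn_common_circ[OF pE tw'[OF \<open>a \<in> V\<close>], of e e] by auto
      then show ?thesis using a(1) by (intro exI[of _ C]) (auto simp: induced_def)
    qed
    show "f ` C \<noteq> f ` E" if "circ C" "C \<subseteq> E" for C
      using pres'[OF that(2,1)] assms(5) fE by metis
  qed (use pres in blast)
  have "\<exists>v\<in>V. {e\<in>E. x \<in> f e} = {e\<in>E. v \<in> e}" if "x \<in> V'" for x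
  proof (rule star_preimage[OF pE EV tc inj])
    obtain e' where "e' \<in> E'" "x \<in> e'" using assms(4) \<open>x \<in> V'\<close> by (auto simp: no_isolated_vertices_def)
    then show "{e\<in>E. x \<in> f e} \<noteq> {}" using fE by blast
    show "pairs (f ` E)" using fE pE' by simp
  qed (use pres deg in auto)
  \<comment> \<open>\<open>\<psi> x\<close> is the centre of the star that is the preimage of the
    star at \<open>x\<close>.\<close>
  then obtain \<psi> where \<psi>: "\<And>x. x \<in> V' \<Longrightarrow> \<psi> x \<in> V"
    "\<And>x. x \<in> V' \<Longrightarrow> {e\<in>E. x \<in> f e} = {e\<in>E. \<psi> x \<in> e}"
    by metis
  have fe: "\<exists>x y. x \<in> V' \<and> y \<in> V' \<and> x \<noteq> y \<and> f e = {x, y}" if "e \<in> E" for e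
    using assms(3) fE that by (fastforce simp: simple_graph_def)
  \<comment> \<open>If \<open>x\<close> and \<open>y\<close> had the same centre, all edges there
    would map to \<open>{x, y}\<close>; there are at least two of them and \<open>f\<close> is
    injective.\<close>
  have inj_psi: "inj_on \<psi> V'"
  proof (rule inj_onI, rule ccontr)
    fix x y assume xy: "x \<in> V'" "y \<in> V'" "\<psi> x = \<psi> y" "x \<noteq> y"
    have eq: "f e = {x, y}" if e: "e \<in> E" "\<psi> x \<in> e" for e
    proof -
      have "x \<in> f e" "y \<in> f e" using \<psi>(2)[OF xy(1)] \<psi>(2)[OF xy(2)] e xy(3) by auto
      then show ?thesis using fe[OF e(1)] xy(4) by auto
    qed
    obtain e1 where e1: "e1 \<in> E" "\<psi> x \<in> e1"
      using three_conn_degree[OF tc pE EV \<psi>(1)[OF xy(1)]] by blast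
    obtain e2 where e2: "e2 \<in> E" "\<psi> x \<in> e2" "e2 \<noteq> e1"
      using three_conn_degree[OF tc pE EV \<psi>(1)[OF xy(1)], of e1 e1] by blast
    show False using eq[OF e1] eq[OF e2(1,2)] inj_onD[OF inj, of e1 e2] e1 e2 by simp
  qed
  have img: "\<psi> ` f e = e" if e: "e \<in> E" for e
  proof -
    obtain x y where xy: "x \<in> V'" "y \<in> V'" "x \<noteq> y" "f e = {x, y}" using fe[OF e] by blast
    then have "\<psi> x \<in> e" "\<psi> y \<in> e" using \<psi>(2)[OF xy(1)] \<psi>(2)[OF xy(2)] e by auto
    moreover have "\<psi> x \<noteq> \<psi> y" using inj_onD[OF inj_psi] xy by blast
    moreover obtain w where "e = {\<psi> x, w}" using pairsE[OF pE e] calculation(1) by blast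
    ultimately show ?thesis using xy(4) by auto
  qed
  have "\<psi> ` V' = V"
  proof (intro equalityI subsetI)
    fix v assume "v \<in> V"
    then obtain e where "e \<in> E" "v \<in> e" using two_conn_edge_at[OF tw] unfolding indV by blast
    then show "v \<in> \<psi> ` V'" using img[of e] fe[of e] by auto
  qed (use \<psi>(1) in blast)
  then have bij: "bij_betw \<psi> V' V" using inj_psi by (simp add: bij_betw_def)
  have "f e = inv_into V' \<psi> ` e" if e: "e \<in> E" for e
  proof -
    have "f e \<subseteq> V'" using fE EV' e by blast
    then show ?thesis using img[OF e] inv_into_image_cancel[OF inj_psi] by metis
  qed
  then show ?thesis using bij_betw_inv_into[OF bij] by blast
qed

end
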